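(* Let $X$ be an infinite dimensional complex Banach space and let $T \in L(X)$. The following conditions are equivalent: (i) $\mathrm{int}\, \sigma_{desc}(T) \subset \sigma_{uw}(T)$; (ii) $T'$ has SVEP at every $\lambda \notin \sigma_{uw}(T)$; (iii) $\sigma_{desc}(T) \subset \sigma_{uw}(T)$; (iv) a-Browder's theorem holds for $T$ and $\sigma(T)=\sigma_{ap}(T)$.
   Context: $L(X)$ is the algebra of bounded linear operators on $X$, $\sigma(T)$ is the spectrum of $T$, $T'$ is the adjoint operator of $T$ acting on the dual space of $X$, and $\mathrm{int}\,F$ is the interior of $F\subset\mathbb{C}$. An operator $S$ on a complex Banach space $Y$ has the single-valued extension property (SVEP) at $\lambda_0\in\mathbb{C}$ if for every open disc $D_{\lambda_0}$ centered at $\lambda_0$ the only analytic function $f:D_{\lambda_0}\to Y$ satisfying $(S-\lambda I)f(\lambda)=0$ for all $\lambda\in D_{\lambda_0}$ is $f\equiv 0$. For $S\in L(X)$, $N(S)$ and $R(S)$ are the null space and range, $\alpha(S)=\dim N(S)$, $\beta(S)=\mathrm{codim}\,R(S)$. $S$ is bounded below if it is injective with closed range. $S$ is upper semi-Fredholm if $R(S)$ is closed and $\alpha(S)<\infty$; then $\mathrm{ind}(S)=\alpha(S)-\beta(S)$. $S$ is upper semi-Weyl if it is upper semi-Fredholm with $\mathrm{ind}(S)\le 0$. The ascent $p(S)$ is the smallest integer $p\ge 0$ with $N(S^p)=N(S^{p+1})$ ($\infty$ if none exists); the descent $q(S)$ is the smallest integer $q\ge 0$ with $R(S^q)=R(S^{q+1})$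 ($\infty$ if none exists). $S$ is upper semi-Browder if it is upper semi-Fredholm with $p(S)<\infty$. The spectra are the sets of $\lambda\in\mathbb{C}$ such that: $T-\lambda I$ is not bounded below ($\sigma_{ap}(T)$); $T-\lambda I$ is not upper semi-Weyl ($\sigma_{uw}(T)$); $T-\lambda I$ is not upper semi-Browder ($\sigma_{ub}(T)$); $q(T-\lambda I)=\infty$ ($\sigma_{desc}(T)$). a-Browder's theorem holds for $T$ if $\sigma_{uw}(T)=\sigma_{ub}(T)$. *)

theory Defs
  imports "HOL-Analysis.Analysis"
begin

class scaleC =
  fixes scaleC :: "complex \<Rightarrow> 'a \<Rightarrow> 'a" (infixr \<open>*\<^sub>C\<close> 75)

class complex_normed_vector = real_normed_vector + scaleC +
  assumes scaleC_add_right: "a *\<^sub>C (x + y) = a *\<^sub>C x + a *\<^sub>C y"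
    and scaleC_add_left: "(a + b) *\<^sub>C x = a *\<^sub>C x + b *\<^sub>C x"
    and scaleC_scaleC: "a *\<^sub>C b *\<^sub>C x = (a * b) *\<^sub>C x"
    and scaleR_scaleC: "scaleR r x = complex_of_real r *\<^sub>C x"
    and norm_scaleC: "norm (a *\<^sub>C x) = cmod a * norm x"

class complex_banach = complex_normed_vector + complete_space

subclass (in complex_banach) banach ..

global_interpretation complex_vector:
  vector_space "scaleC :: complex \<Rightarrow> 'a \<Rightarrow> 'a :: complex_normed_vector"
proof
  show "1 *\<^sub>C x = x" for x :: 'a
    using scaleR_scaleC[of 1 x] by simp
qed (auto simp: scaleC_add_right scaleC_add_left scaleC_scaleC)

text \<open>Membership in the algebra of bounded operators; \<open>bounded_linear\<close> alone is
  only real linearity.\<close>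

definition bounded_clinear ::
  "('a::complex_normed_vector \<Rightarrow> 'b::complex_normed_vector) \<Rightarrow> bool" where
  "bounded_clinear T \<longleftrightarrow> bounded_linear T \<and> (\<forall>c x. T (c *\<^sub>C x) = c *\<^sub>C T x)"

text \<open>The norm is the operator norm inherited from the real bounded linear functions into
  the complex numbers.\<close>

typedef (overloaded) 'a cdual =
  "{f :: 'a::complex_normed_vector \<Rightarrow>\<^sub>L complex. \<forall>c x. blinfun_apply f (c *\<^sub>C x) = c * blinfun_apply f x}"
  by (rule exI[of _ 0]) simp

setup_lifting type_definition_cdual

lift_definition cdual_apply :: "'a::complex_normed_vector cdual \<Rightarrow> 'a \<Rightarrow> complex"
  is blinfun_apply .

lemma cdual_eqI: "(\<And>x. cdual_apply f x = cdual_apply g x) \<Longrightarrow> f = g"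
  by transfer (rule blinfun_eqI)

instantiation cdual :: (complex_normed_vector) complex_normed_vector
begin

lift_definition zero_cdual :: "'a cdual" is 0 by simp
lift_definition plus_cdual :: "'a cdual \<Rightarrow> 'a cdual \<Rightarrow> 'a cdual" is "(+)"
  by (simp add: blinfun.add_left algebra_simps)
lift_definition minus_cdual :: "'a cdual \<Rightarrow> 'a cdual \<Rightarrow> 'a cdual" is "(-)"
  by (simp add: blinfun.diff_left algebra_simps)
lift_definition uminus_cdual :: "'a cdual \<Rightarrow> 'a cdual" is uminus
  by (simp add: blinfun.minus_left)
lift_definition scaleR_cdual :: "real \<Rightarrow> 'a cdual \<Rightarrow> 'a cdual" is scaleR
  by (simp add: blinfun.scaleR_left)
lift_definition scaleC_cdual :: "complex \<Rightarrow> 'a cdual \<Rightarrow> 'a cdual"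
  is "\<lambda>c f. blinfun_mult_right c o\<^sub>L f"
  by simp
lift_definition norm_cdual :: "'a cdual \<Rightarrow> real" is norm .
definition dist_cdual :: "'a cdual \<Rightarrow> 'a cdual \<Rightarrow> real"
  where "dist_cdual f g = norm (f - g)"
definition sgn_cdual :: "'a cdual \<Rightarrow> 'a cdual"
  where "sgn_cdual f = scaleR (inverse (norm f)) f"
definition uniformity_cdual :: "('a cdual \<times> 'a cdual) filter"
  where "uniformity_cdual = (INF e\<in>{0 <..}. principal {(x, y). dist x y < e})"
definition open_cdual :: "'a cdual set \<Rightarrow> bool"
  where "open_cdual S = (\<forall>x\<in>S. \<forall>\<^sub>F (x', y) in uniformity. x' = x \<longrightarrow> y \<in> S)"

instance
proof
  fix a b :: complex and r s :: real and f g h :: "'a cdual"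
  show "f + g + h = f + (g + h)" "f + g = g + f" "0 + f = f" "- f + f = 0" "f - g = f + - g"
    by (transfer; simp)+
  show "r *\<^sub>R (f + g) = r *\<^sub>R f + r *\<^sub>R g" "(r + s) *\<^sub>R f = r *\<^sub>R f + s *\<^sub>R f"
    "r *\<^sub>R s *\<^sub>R f = (r * s) *\<^sub>R f" "1 *\<^sub>R f = f"
    by (transfer; simp add: scaleR_add_right scaleR_add_left)+
  show "dist f g = norm (f - g)" by (rule dist_cdual_def)
  show "sgn f = inverse (norm f) *\<^sub>R f" by (rule sgn_cdual_def)
  show "uniformity = (INF e\<in>{0 <..}. principal {(x :: 'a cdual, y). dist x y < e})"
    by (rule uniformity_cdual_def)
  show "open U = (\<forall>x\<in>U. \<forall>\<^sub>F (x', y) in uniformity. x' = x \<longrightarrow> y \<in> U)" for U :: "'a cdual set"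
    by (rule open_cdual_def)
  show "(norm f = 0) = (f = 0)" "norm (r *\<^sub>R f) = \<bar>r\<bar> * norm f"
    by (transfer; simp)+
  show "norm (f + g) \<le> norm f + norm g"
    by transfer (rule norm_triangle_ineq)
  show "a *\<^sub>C (f + g) = a *\<^sub>C f + a *\<^sub>C g" "(a + b) *\<^sub>C f = a *\<^sub>C f + b *\<^sub>C f"
    "a *\<^sub>C b *\<^sub>C f = (a * b) *\<^sub>C f"
    by (transfer; rule blinfun_eqI; simp add: blinfun.add_left distrib_left distrib_right mult.assoc)+
  show "r *\<^sub>R f = complex_of_real r *\<^sub>C f"
    by (transfer; rule blinfun_eqI; simp add: blinfun.scaleR_left scaleR_conv_of_real)
  show "norm (a *\<^sub>C f) = cmod a * norm f"
  proof transfer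
    fix a and f :: "'a \<Rightarrow>\<^sub>L complex"
    have le: "norm (blinfun_mult_right c o\<^sub>L k) \<le> cmod c * norm k"
      for c and k :: "'a \<Rightarrow>\<^sub>L complex"
    proof (rule norm_blinfun_bound)
      show "norm (blinfun_apply (blinfun_mult_right c o\<^sub>L k) x) \<le> cmod c * norm k * norm x" for x
        using norm_blinfun[of k x] by (simp add: norm_mult mult.assoc mult_left_mono)
    qed simp
    show "norm (blinfun_mult_right a o\<^sub>L f) = cmod a * norm f"
    proof (cases "a = 0")
      case True
      then have "blinfun_mult_right a o\<^sub>L f = 0"
        by (intro blinfun_eqI) simp
      with True show ?thesis by simp
    next
      case False
      let ?g = "blinfun_mult_right a o\<^sub>L f"
      have "blinfun_mult_right (inverse a) o\<^sub>L ?g = f"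
        using False by (intro blinfun_eqI) simp
      with le[of "inverse a" ?g] have "norm f \<le> inverse (cmod a) * norm ?g"
        by (simp add: norm_inverse)
      then have "cmod a * norm f \<le> cmod a * (inverse (cmod a) * norm ?g)"
        by (rule mult_left_mono) simp
      also have "\<dots> = norm ?g" using False by simp
      finally show ?thesis using le[of a f] by simp
    qed
  qed
qed

end

lemma cdual_apply_scaleC [simp]: "cdual_apply (c *\<^sub>C f) x = c * cdual_apply f x"
  by transfer simp

lemma cdual_apply_scaleC_right [simp]: "cdual_apply f (c *\<^sub>C x) = c * cdual_apply f x"
  by transfer simp

lemma cdual_apply_add [simp]: "cdual_apply (f + g) x = cdual_apply f x + cdual_apply g x"
  by transfer (simp add: blinfun.add_left)

lemma bounded_linear_cdual_apply: "bounded_linear (cdual_apply f)"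
  by transfer (rule blinfun.bounded_linear_right)

lemma norm_cdual_eq_onorm: "norm f = onorm (cdual_apply f)"
  by transfer (rule norm_blinfun.rep_eq)

instance cdual :: (complex_normed_vector) complex_banach
proof
  fix X :: "nat \<Rightarrow> 'a cdual"
  assume X: "Cauchy X"
  have dist_Rep: "dist (Rep_cdual f) (Rep_cdual g) = dist f g" for f g :: "'a cdual"
    by (simp add: dist_norm norm_cdual.rep_eq minus_cdual.rep_eq)
  have "Cauchy (\<lambda>n. Rep_cdual (X n))"
    using X by (simp add: Cauchy_def dist_Rep)
  then obtain L where L: "(\<lambda>n. Rep_cdual (X n)) \<longlonglongrightarrow> L"
    using Cauchy_convergent convergent_def by blast
  have pt: "(\<lambda>n. blinfun_apply (Rep_cdual (X n)) x) \<longlonglongrightarrow> blinfun_apply L x" for x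
    by (intro blinfun.tendsto L tendsto_const)
  have "blinfun_apply L (c *\<^sub>C x) = c * blinfun_apply L x" for c x
  proof (rule LIMSEQ_unique[OF pt])
    have "blinfun_apply (Rep_cdual (X n)) (c *\<^sub>C x) = c * blinfun_apply (Rep_cdual (X n)) x" for n
      using Rep_cdual[of "X n"] by simp
    then show "(\<lambda>n. blinfun_apply (Rep_cdual (X n)) (c *\<^sub>C x)) \<longlonglongrightarrow> c * blinfun_apply L x"
      by (simp add: tendsto_mult_left pt)
  qed
  then have "Rep_cdual (Abs_cdual L) = L"
    by (simp add: Abs_cdual_inverse)
  then have "X \<longlonglongrightarrow> Abs_cdual L"
    using L by (simp add: lim_sequentially flip: dist_Rep)
  then show "convergent X" by (rule convergentI)
qed

text \<open>For \<open>T\<close> in the algebra of bounded operators this is the Banach space adjoint, see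
  \<open>cdual_apply_adjoint\<close> below; otherwise the value is meaningless.\<close>

definition cadjoint :: "('a::complex_normed_vector \<Rightarrow> 'a) \<Rightarrow> 'a cdual \<Rightarrow> 'a cdual" where
  "cadjoint T f = Abs_cdual (Blinfun (\<lambda>x. cdual_apply f (T x)))"

lemma cdual_apply_adjoint:
  assumes "bounded_clinear T"
  shows "cdual_apply (cadjoint T f) x = cdual_apply f (T x)"
proof -
  have bl: "bounded_linear (\<lambda>x. cdual_apply f (T x))"
    using assms bounded_linear_compose[OF bounded_linear_cdual_apply]
    by (auto simp: bounded_clinear_def)
  have "Blinfun (\<lambda>x. cdual_apply f (T x)) \<in>
      {f. \<forall>c x. blinfun_apply f (c *\<^sub>C x) = c * blinfun_apply f x}"
    using assms by (simp add: bounded_linear_Blinfun_apply[OF bl] bounded_clinear_def)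
  then show ?thesis
    by (simp add: cadjoint_def cdual_apply.rep_eq[of "Abs_cdual _"] Abs_cdual_inverse
        bounded_linear_Blinfun_apply[OF bl])
qed

lemma bounded_clinear_cadjoint:
  assumes "bounded_clinear T"
  shows "bounded_clinear (cadjoint T)"
  unfolding bounded_clinear_def
proof (intro conjI allI)
  from assms have T: "bounded_linear T" by (simp add: bounded_clinear_def)
  note A = cdual_apply_adjoint[OF assms]
  show C: "cadjoint T (c *\<^sub>C f) = c *\<^sub>C cadjoint T f" for c f
    by (rule cdual_eqI) (simp add: A)
  show "bounded_linear (cadjoint T)"
  proof (rule bounded_linear_intro)
    show "cadjoint T (f + g) = cadjoint T f + cadjoint T g" for f g
      by (rule cdual_eqI) (simp add: A)
    show "cadjoint T (r *\<^sub>R f) = r *\<^sub>R cadjoint T f" for r f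
      by (simp add: scaleR_scaleC C)
    show "norm (cadjoint T f) \<le> norm f * onorm T" for f
    proof -
      have "cdual_apply (cadjoint T f) = cdual_apply f \<circ> T"
        by (simp add: fun_eq_iff A)
      then show ?thesis
        using onorm_compose[OF bounded_linear_cdual_apply[of f] T]
        by (simp add: norm_cdual_eq_onorm)
    qed
  qed
qed

definition cdim :: "'a::complex_normed_vector set \<Rightarrow> enat" where
  "cdim V = (if \<exists>B. finite B \<and> V \<subseteq> complex_vector.span B
             then enat (complex_vector.dim V) else \<infinity>)"

definition ccomplement :: "'a::complex_normed_vector set \<Rightarrow> 'a set \<Rightarrow> bool" where
  "ccomplement V W \<longleftrightarrow> complex_vector.subspace W \<and> V \<inter> W = {0} \<and> (\<forall>x. \<exists>v\<in>V. \<exists>w\<in>W. x = v + w)"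

text \<open>The dimension of the quotient by \<open>V\<close>, realised on an algebraic complement. A complement
  exists and its choice is immaterial by \<open>ex_ccomplement\<close> and \<open>ccodim_eq\<close>;
  \<open>cdim_range_eq_ccodim\<close> is the identification with the quotient.\<close>

definition ccodim :: "'a::complex_normed_vector set \<Rightarrow> enat" where
  "ccodim V = cdim (SOME W. ccomplement V W)"

abbreviation clinear :: "('a::complex_normed_vector \<Rightarrow> 'b::complex_normed_vector) \<Rightarrow> bool" where
  "clinear \<equiv> Vector_Spaces.linear scaleC scaleC"

lemma cdim_image_inj:
  fixes f :: "'a::complex_normed_vector \<Rightarrow> 'b::complex_normed_vector"
  assumes f: "clinear f" and W: "complex_vector.subspace W" and inj: "inj_on f W"
  shows "cdim (f ` W) = cdim W"
proof -
  interpret P: vector_space_pair "scaleC :: complex \<Rightarrow> 'a \<Rightarrow> 'a" "scaleC :: complex \<Rightarrow> 'b \<Rightarrow> 'b" ..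
  interpret Q: vector_space_pair "scaleC :: complex \<Rightarrow> 'b \<Rightarrow> 'b" "scaleC :: complex \<Rightarrow> 'a \<Rightarrow> 'a" ..
  obtain C where C: "C \<subseteq> W" "complex_vector.independent C" "W \<subseteq> complex_vector.span C"
    "card C = complex_vector.dim W"
    using complex_vector.basis_exists by blast
  have spC: "complex_vector.span C = W"
    using C W by (metis complex_vector.span_subspace)
  have indep: "complex_vector.independent (f ` C)"
    using P.linear_independent_injective_image[OF f C(2)] inj spC by simp
  have "f ` W = complex_vector.span (f ` C)"
    using P.linear_span_image[OF f, of C] spC by simp
  then have "complex_vector.dim (f ` W) = card (f ` C)"
    using complex_vector.dim_span_eq_card_independent[OF indep] by simp
  also have "\<dots> = card C"
    using inj C(1) by (meson card_image inj_on_subset)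
  finally have dim: "complex_vector.dim (f ` W) = complex_vector.dim W"
    using C(4) by simp
  obtain g where g: "clinear g" "\<And>x. x \<in> W \<Longrightarrow> g (f x) = x"
    using P.linear_exists_left_inverse_on[OF f W inj] by blast
  have "(\<exists>B. finite B \<and> W \<subseteq> complex_vector.span B) \<longleftrightarrow>
      (\<exists>B. finite B \<and> f ` W \<subseteq> complex_vector.span B)"
  proof
    assume "\<exists>B. finite B \<and> W \<subseteq> complex_vector.span B"
    then obtain B where "finite B" "W \<subseteq> complex_vector.span B" by blast
    then have "finite (f ` B)" "f ` W \<subseteq> complex_vector.span (f ` B)"
      using P.linear_span_image[OF f, of B] by auto
    then show "\<exists>B. finite B \<and> f ` W \<subseteq> complex_vector.span B" by blast
  next
    assume "\<exists>B. finite B \<and> f ` W \<subseteq> complex_vector.span B"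
    then obtain B where B: "finite B" "f ` W \<subseteq> complex_vector.span B" by blast
    have "g ` f ` W \<subseteq> complex_vector.span (g ` B)"
      using Q.linear_span_image[OF g(1), of B] B(2) by auto
    moreover have "g ` f ` W = W" using g(2) by force
    ultimately show "\<exists>B. finite B \<and> W \<subseteq> complex_vector.span B" using B(1) by auto
  qed
  with dim show ?thesis by (simp add: cdim_def)
qed

lemma cdim_range_eq_complement:
  fixes f :: "'a::complex_normed_vector \<Rightarrow> 'b::complex_normed_vector"
  assumes f: "clinear f" and V: "{x. f x = 0} = V" and W: "ccomplement V W"
  shows "cdim (range f) = cdim W"
proof -
  interpret f: Vector_Spaces.linear scaleC scaleC f by (rule f)
  have sW: "complex_vector.subspace W" using W by (simp add: ccomplement_def)
  have "inj_on f W"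
  proof (rule inj_onI)
    fix x y assume xy: "x \<in> W" "y \<in> W" "f x = f y"
    then have "x - y \<in> V \<inter> W"
      using V sW by (auto simp: f.diff complex_vector.subspace_diff)
    then have "x - y \<in> {0}" using W by (simp only: ccomplement_def)
    then show "x = y" by simp
  qed
  moreover have "range f = f ` W"
  proof -
    have "f x \<in> f ` W" for x
    proof -
      obtain v w where "v \<in> V" "w \<in> W" "x = v + w"
        using W unfolding ccomplement_def by blast
      then show ?thesis using V by (auto simp: f.add)
    qed
    then show ?thesis by auto
  qed
  ultimately show ?thesis using cdim_image_inj[OF f sW] by simp
qed

lemma ex_ccomplement:
  fixes V :: "'a::complex_normed_vector set"
  assumes V: "complex_vector.subspace V"
  shows "\<exists>W. ccomplement V W"
proof -
  interpret P: vector_space_pair "scaleC :: complex \<Rightarrow> 'a \<Rightarrow> 'a" "scaleC :: complex \<Rightarrow> 'a \<Rightarrow> 'a" ..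
  have "clinear (id :: 'a \<Rightarrow> 'a)" by (rule complex_vector.linear_id)
  then obtain p :: "'a \<Rightarrow> 'a" where p: "p ` UNIV \<subseteq> V" "clinear p" "\<And>v. v \<in> V \<Longrightarrow> p v = v"
    using P.linear_exists_left_inverse_on[of id V] V
    by (auto simp: complex_vector.span_eq_iff[THEN iffD2])
  interpret p: Vector_Spaces.linear scaleC scaleC p by (rule p(2))
  have "ccomplement V {x. p x = 0}"
    unfolding ccomplement_def
  proof (intro conjI allI)
    show "complex_vector.subspace {x. p x = 0}"
      by (rule p.subspace_kernel)
    show "V \<inter> {x. p x = 0} = {0}"
      using p(3) V by (auto simp: complex_vector.subspace_0 p.zero)
    show "\<exists>v\<in>V. \<exists>w\<in>{x. p x = 0}. x = v + w" for x
    proof (rule bexI[of _ "p x"], rule bexI[of _ "x - p x"])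
      show pV: "p x \<in> V" using p(1) by auto
      show "x - p x \<in> {x. p x = 0}" using p(3)[OF pV] by (simp add: p.diff)
    qed simp
  qed
  then show ?thesis ..
qed

lemma ex_projection:
  fixes V :: "'a::complex_normed_vector set"
  assumes V: "complex_vector.subspace V" and W: "ccomplement V W"
  shows "\<exists>p :: 'a \<Rightarrow> 'a. clinear p \<and> {x. p x = 0} = V \<and> range p = W"
proof -
  have sW: "complex_vector.subspace W" and VW: "V \<inter> W = {0}"
    and dec: "\<And>x. \<exists>v\<in>V. \<exists>w\<in>W. x = v + w"
    using W by (auto simp: ccomplement_def)
  have "\<exists>w. w \<in> W \<and> x - w \<in> V" for x
    using dec[of x] by auto
  then obtain p where p: "\<And>x. p x \<in> W \<and> x - p x \<in> V"
    by metis
  have uniq: "p x = w" if "w \<in> W" "x - w \<in> V" for x w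
  proof -
    have "(x - w) - (x - p x) \<in> V"
      using complex_vector.subspace_diff[OF V that(2)] p by blast
    moreover have "p x - w \<in> W"
      using complex_vector.subspace_diff[OF sW _ that(1)] p by blast
    ultimately have "p x - w \<in> {0}" unfolding VW[symmetric] by simp
    then show ?thesis by simp
  qed
  have "p (x + y) = p x + p y" for x y
  proof (rule uniq)
    show "p x + p y \<in> W" using p sW by (simp add: complex_vector.subspace_add)
    have "(x - p x) + (y - p y) \<in> V"
      using complex_vector.subspace_add[OF V] p by blast
    then show "x + y - (p x + p y) \<in> V" by (simp add: algebra_simps)
  qed
  moreover have "p (c *\<^sub>C x) = c *\<^sub>C p x" for c x
  proof (rule uniq)
    show "c *\<^sub>C p x \<in> W" using p sW by (simp add: complex_vector.subspace_scale)
    have "c *\<^sub>C (x - p x) \<in> V"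
      using complex_vector.subspace_scale[OF V] p by blast
    then show "c *\<^sub>C x - c *\<^sub>C p x \<in> V"
      by (simp add: complex_vector.scale_right_diff_distrib)
  qed
  ultimately have "clinear p"
    by (simp add: Vector_Spaces.linear_iff complex_vector.vector_space_axioms)
  moreover have "{x. p x = 0} = V"
  proof (intro set_eqI iffI)
    show "x \<in> V" if "x \<in> {x. p x = 0}" for x
      using p[of x] that by simp
    show "x \<in> {x. p x = 0}" if "x \<in> V" for x
      using uniq[of 0 x] that sW by (simp add: complex_vector.subspace_0)
  qed
  moreover have "range p = W"
  proof -
    have "p w = w" if "w \<in> W" for w
      using that V by (intro uniq) (auto simp: complex_vector.subspace_0)
    then have "W \<subseteq> range p" by (metis rangeI subsetI)
    then show ?thesis using p by auto
  qed
  ultimately show ?thesis by blast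
qed

lemma ccodim_eq:
  assumes V: "complex_vector.subspace V" and W: "ccomplement V W"
  shows "ccodim V = cdim W"
proof -
  have W': "ccomplement V (SOME W. ccomplement V W)" using W by (rule someI)
  obtain p where "clinear p" "{x. p x = 0} = V" "range p = W"
    using ex_projection[OF V W] by blast
  then show ?thesis
    using cdim_range_eq_complement[of p, OF _ _ W'] by (simp add: ccodim_def)
qed

lemma cdim_range_eq_ccodim:
  fixes f :: "'a::complex_normed_vector \<Rightarrow> 'b::complex_normed_vector"
  assumes f: "clinear f"
  shows "cdim (range f) = ccodim {x. f x = 0}"
proof -
  interpret f: Vector_Spaces.linear scaleC scaleC f by (rule f)
  obtain W where "ccomplement {x. f x = 0} W"
    using ex_ccomplement[OF f.subspace_kernel] by blast
  then show ?thesis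
    using cdim_range_eq_complement[OF f refl] ccodim_eq[OF f.subspace_kernel] by simp
qed

definition null_space :: "('a::complex_normed_vector \<Rightarrow> 'a) \<Rightarrow> 'a set" where
  "null_space S = {x. S x = 0}"

definition nullity :: "('a::complex_normed_vector \<Rightarrow> 'a) \<Rightarrow> enat" where
  "nullity S = cdim (null_space S)"

definition deficiency :: "('a::complex_normed_vector \<Rightarrow> 'a) \<Rightarrow> enat" where
  "deficiency S = ccodim (range S)"

definition bounded_below :: "('a::complex_normed_vector \<Rightarrow> 'a) \<Rightarrow> bool" where
  "bounded_below S \<longleftrightarrow> inj S \<and> closed (range S)"

definition upper_semi_Fredholm :: "('a::complex_normed_vector \<Rightarrow> 'a) \<Rightarrow> bool" where
  "upper_semi_Fredholm S \<longleftrightarrow> closed (range S) \<and> nullity S < \<infinity>"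

text \<open>For an upper semi-Fredholm operator the first term is finite, so this is an integer
  or \<open>-\<infinity>\<close>.\<close>

definition fredholm_index :: "('a::complex_normed_vector \<Rightarrow> 'a) \<Rightarrow> ereal" where
  "fredholm_index S = ereal_of_enat (nullity S) - ereal_of_enat (deficiency S)"

definition upper_semi_Weyl :: "('a::complex_normed_vector \<Rightarrow> 'a) \<Rightarrow> bool" where
  "upper_semi_Weyl S \<longleftrightarrow> upper_semi_Fredholm S \<and> fredholm_index S \<le> 0"

text \<open>The infimum of the empty set in \<^typ>\<open>enat\<close> is \<open>\<infinity>\<close>.\<close>

definition ascent :: "('a::complex_normed_vector \<Rightarrow> 'a) \<Rightarrow> enat" where
  "ascent S = Inf {enat p | p. null_space (S ^^ p) = null_space (S ^^ (p + 1))}"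

definition descent :: "('a::complex_normed_vector \<Rightarrow> 'a) \<Rightarrow> enat" where
  "descent S = Inf {enat q | q. range (S ^^ q) = range (S ^^ (q + 1))}"

definition upper_semi_Browder :: "('a::complex_normed_vector \<Rightarrow> 'a) \<Rightarrow> bool" where
  "upper_semi_Browder S \<longleftrightarrow> upper_semi_Fredholm S \<and> ascent S < \<infinity>"

definition shift :: "('a::complex_normed_vector \<Rightarrow> 'a) \<Rightarrow> complex \<Rightarrow> 'a \<Rightarrow> 'a" where
  "shift T \<mu> = (\<lambda>x. T x - \<mu> *\<^sub>C x)"

definition spectrum :: "('a::complex_normed_vector \<Rightarrow> 'a) \<Rightarrow> complex set" where
  "spectrum T = {\<mu>. \<not> (\<exists>R. bounded_clinear R \<and> R \<circ> shift T \<mu> = id \<and> shift T \<mu> \<circ> R = id)}"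

definition ap_spectrum :: "('a::complex_normed_vector \<Rightarrow> 'a) \<Rightarrow> complex set" where
  "ap_spectrum T = {\<mu>. \<not> bounded_below (shift T \<mu>)}"

definition uw_spectrum :: "('a::complex_normed_vector \<Rightarrow> 'a) \<Rightarrow> complex set" where
  "uw_spectrum T = {\<mu>. \<not> upper_semi_Weyl (shift T \<mu>)}"

definition ub_spectrum :: "('a::complex_normed_vector \<Rightarrow> 'a) \<Rightarrow> complex set" where
  "ub_spectrum T = {\<mu>. \<not> upper_semi_Browder (shift T \<mu>)}"

definition desc_spectrum :: "('a::complex_normed_vector \<Rightarrow> 'a) \<Rightarrow> complex set" where
  "desc_spectrum T = {\<mu>. descent (shift T \<mu>) = \<infinity>}"

definition a_Browder_theorem :: "('a::complex_normed_vector \<Rightarrow> 'a) \<Rightarrow> bool" where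
  "a_Browder_theorem T \<longleftrightarrow> uw_spectrum T = ub_spectrum T"

text \<open>Complex differentiability at every point of an open set; the library's
  \<^const>\<open>holomorphic_on\<close> is restricted to functions with values in a normed field.\<close>

definition vector_holomorphic_on ::
  "(complex \<Rightarrow> 'a::complex_normed_vector) \<Rightarrow> complex set \<Rightarrow> bool" where
  "vector_holomorphic_on f D \<longleftrightarrow> (\<forall>z\<in>D. \<exists>d. (f has_derivative (\<lambda>h. h *\<^sub>C d)) (at z))"

definition SVEP_at :: "('a::complex_banach \<Rightarrow> 'a) \<Rightarrow> complex \<Rightarrow> bool" where
  "SVEP_at S \<mu>\<^sub>0 \<longleftrightarrow>
    (\<forall>r>0. \<forall>f. vector_holomorphic_on f (ball \<mu>\<^sub>0 r) \<and> (\<forall>\<mu>\<in>ball \<mu>\<^sub>0 r. shift S \<mu> (f \<mu>) = 0)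
      \<longrightarrow> (\<forall>\<mu>\<in>ball \<mu>\<^sub>0 r. f \<mu> = 0))"

end

theory Submission
  imports Defs "HOL-Complex_Analysis.Conformal_Mappings"
begin

text \<open>
  Write \<open>S = T - \<mu>I\<close>. The four conditions are linked by the circle (i) \<open>\<Rightarrow>\<close> (ii) \<open>\<Rightarrow>\<close> (iii) \<open>\<Rightarrow>\<close> (i)
  and the equivalence (iii) \<open>\<Leftrightarrow>\<close> (iv); the last step of the circle is trivial.

  (i) \<open>\<Rightarrow>\<close> (ii). Let \<open>f\<close> be an analytic section of the kernels \<open>N(T' - zI)\<close> and \<open>\<phi>\<^sub>x(z) = f(z)(x)\<close>.
  Then \<open>f(z)(S x) = (z - \<mu>) \<phi>\<^sub>x(z)\<close>. If \<open>S\<close> has finite descent \<open>q\<close>, then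
  \<open>X = R(S\<^sup>k) + N(S\<^sup>q)\<close> for every \<open>k\<close>; the second summand contributes nothing to \<open>\<phi>\<^sub>x\<close> and the first
  one forces a zero of order \<open>k\<close> at \<open>\<mu>\<close>. So \<open>\<phi>\<^sub>x\<close> is flat, and \<open>f = 0\<close> near \<open>\<mu>\<close>
  (\<open>adjoint_kernel_section_eq_0\<close>). If \<open>\<mu>\<close> is not interior to the descent spectrum, a point of
  finite descent lies in every disc around \<open>\<mu>\<close>, and the identity theorem gives SVEP at \<open>\<mu>\<close>.

  (ii) \<open>\<Rightarrow>\<close> (iii). Let \<open>S\<close> be upper semi-Fredholm of infinite descent. Since \<open>N(S)\<close> is finite
  dimensional, \<open>N(S) \<inter> R(S\<^sup>n)\<close> is eventually constant, so all \<open>N(S\<^sup>m)\<close> lie in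
  \<open>V = R(S) + N(S\<^sup>q)\<close> for some \<open>q\<close>. This \<open>V\<close> is closed, and it is not \<open>X\<close> because the descent is infinite.
  A unit functional \<open>a\<^sub>0\<close> vanishing on \<open>V\<close> starts a backward orbit \<open>S'a\<^sub>0 = 0\<close>, \<open>S'a\<^sub>k\<^sub>+\<^sub>1 = a\<^sub>k\<close> of at
  most geometric growth, and \<open>\<Sum> (z - \<mu>)\<^sup>k a\<^sub>k\<close> is a nonzero analytic section of the kernels of
  \<open>T' - zI\<close> (\<open>descent_finite_if_adjoint_SVEP\<close>).

  (iii) \<open>\<Leftrightarrow>\<close> (iv). On a finite dimensional subspace \<open>N\<close> containing \<open>N(S)\<close>, rank and nullity of \<open>S\<close>
  and of the quotient map modulo \<open>R(S)\<close> can be compared (\<open>nullity_deficiency_balance\<close>). With \<open>N = N(S\<^sup>n)\<close>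
  this shows that finite ascent implies \<open>\<alpha>(S) \<le> \<beta>(S)\<close>, and that finite descent together with
  \<open>\<alpha>(S) \<le> \<beta>(S)\<close> implies finite ascent. Hence (iii) makes upper semi-Weyl and upper semi-Browder
  equivalent, and it makes every bounded below \<open>T - \<mu>I\<close> surjective. Conversely, if \<open>S\<close> is upper
  semi-Browder then all \<open>S - \<nu>I\<close> with small \<open>\<nu> \<noteq> 0\<close> are bounded below, so they are invertible
  by (iv); solving \<open>(S - \<nu>I) x\<^sub>\<nu> = y\<close> inside \<open>R(S\<^sup>p)\<close> and letting \<open>\<nu>\<close> tend to \<open>0\<close> gives
  \<open>R(S\<^sup>p) = R(S\<^sup>p\<^sup>+\<^sup>1)\<close> (\<open>descent_finite_if_nearby_surjective\<close>).

  The functional analysis behind this consists of the open mapping theorem, the closedness of a closed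
  subspace plus a finite dimensional one, and the Hahn-Banach theorem.
\<close>

section \<open>Dimension of complex subspaces\<close>

lemma cdim_finite_iff: "cdim V < \<infinity> \<longleftrightarrow> (\<exists>B. finite B \<and> V \<subseteq> complex_vector.span B)"
  by (simp add: cdim_def)

lemma cdim_finite_basis:
  assumes "cdim V < \<infinity>"
  obtains B where "finite B" "B \<subseteq> V" "complex_vector.independent B"
    "V \<subseteq> complex_vector.span B" "cdim V = enat (card B)"
proof -
  obtain B where B: "B \<subseteq> V" "complex_vector.independent B" "V \<subseteq> complex_vector.span B"
    "card B = complex_vector.dim V"
    using complex_vector.basis_exists by blast
  obtain A where A: "finite A" "V \<subseteq> complex_vector.span A"
    using assms cdim_finite_iff by blast
  have "finite B"
    using complex_vector.independent_span_bound[OF A(1) B(2)] A(2) B(1) by auto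
  moreover have "cdim V = enat (card B)"
    using A B(4) unfolding cdim_def by auto
  ultimately show thesis
    using that[of B] B by blast
qed

lemma cdim_span_independent:
  assumes "finite B" "complex_vector.independent B"
  shows "cdim (complex_vector.span B) = enat (card B)"
  using assms by (auto simp: cdim_def complex_vector.dim_eq_card_independent)

lemma cdim_mono:
  assumes "V \<subseteq> W"
  shows "cdim V \<le> cdim W"
proof (cases "cdim W < \<infinity>")
  case True
  then obtain B where B: "finite B" "W \<subseteq> complex_vector.span B" "cdim W = enat (card B)"
    by (rule cdim_finite_basis)
  then have "complex_vector.dim V \<le> card B"
    using assms complex_vector.dim_le_card by blast
  moreover have "\<exists>B. finite B \<and> V \<subseteq> complex_vector.span B"
    using B assms by blast
  ultimately show ?thesis
    using B by (simp add: cdim_def)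
qed simp

lemma cdim_finite_subset: "V \<subseteq> W \<Longrightarrow> cdim W < \<infinity> \<Longrightarrow> cdim V < \<infinity>"
  by (rule order.strict_trans1[OF cdim_mono])

lemma cdim_eq_imp_eq:
  assumes V: "complex_vector.subspace V" and VW: "V \<subseteq> W"
    and fin: "cdim W < \<infinity>" and le: "cdim W \<le> cdim V"
  shows "V = W"
proof -
  have finV: "cdim V < \<infinity>" using VW fin by (rule cdim_finite_subset)
  obtain B where B: "finite B" "B \<subseteq> V" "complex_vector.independent B"
    "V \<subseteq> complex_vector.span B" "cdim V = enat (card B)"
    using cdim_finite_basis[OF finV] by blast
  obtain D where D: "B \<subseteq> D" "D \<subseteq> W" "complex_vector.independent D" "W \<subseteq> complex_vector.span D"
    using complex_vector.maximal_independent_subset_extend[of B W] B VW by blast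
  obtain A where A: "finite A" "W \<subseteq> complex_vector.span A"
    using fin cdim_finite_iff by blast
  have "finite D"
    using complex_vector.independent_span_bound[OF A(1) D(3)] A(2) D(2) by auto
  moreover have "card D = complex_vector.dim W"
    using complex_vector.basis_card_eq_dim D by blast
  ultimately have "card D \<le> card B"
    using le B(5) fin by (simp add: cdim_def split: if_splits)
  then have "B = D"
    using \<open>finite D\<close> D(1) card_seteq by blast
  then have "W \<subseteq> complex_vector.span B" using D by simp
  also have "\<dots> \<subseteq> V" using B(2) V by (rule complex_vector.span_minimal)
  finally show ?thesis using VW by blast
qed

text \<open>
  A basis of the kernel part extends to a basis of \<open>N\<close>; on the span of the added vectors \<open>f\<close> is
  injective and has the same image as on \<open>N\<close>.
\<close>

lemma rank_nullity:
  fixes f :: "'a::complex_normed_vector \<Rightarrow> 'b::complex_normed_vector"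
  assumes f: "clinear f" and N: "complex_vector.subspace N" and fin: "cdim N < \<infinity>"
  shows "cdim N = cdim (N \<inter> {x. f x = 0}) + cdim (f ` N)"
proof -
  interpret f: Vector_Spaces.linear scaleC scaleC f by (rule f)
  interpret P: vector_space_pair "scaleC :: complex \<Rightarrow> 'a \<Rightarrow> 'a" "scaleC :: complex \<Rightarrow> 'b \<Rightarrow> 'b" ..
  interpret Q: vector_space_pair "scaleC :: complex \<Rightarrow> 'a \<Rightarrow> 'a" "scaleC :: complex \<Rightarrow> 'a \<Rightarrow> 'a" ..
  let ?K = "N \<inter> {x. f x = 0}"
  have K: "complex_vector.subspace ?K"
    using N f.subspace_kernel by (rule complex_vector.subspace_inter)
  have "cdim ?K < \<infinity>" using fin by (rule cdim_finite_subset[rotated]) simp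
  then obtain C where C: "finite C" "C \<subseteq> ?K" "complex_vector.independent C"
    "?K \<subseteq> complex_vector.span C" "cdim ?K = enat (card C)"
    using cdim_finite_basis by blast
  obtain B where B: "C \<subseteq> B" "B \<subseteq> N" "complex_vector.independent B" "N \<subseteq> complex_vector.span B"
    using complex_vector.maximal_independent_subset_extend[of C N] C by blast
  obtain A where A: "finite A" "N \<subseteq> complex_vector.span A"
    using fin cdim_finite_iff by blast
  have finB: "finite B"
    using complex_vector.independent_span_bound[OF A(1) B(3)] A(2) B(2) by auto
  have N_eq: "N = complex_vector.span B"
    using B N by (metis complex_vector.span_subspace)
  let ?D = "B - C"
  have indD: "complex_vector.independent ?D"
    using B(3) by (rule complex_vector.independent_mono) auto
  have inj: "inj_on f (complex_vector.span ?D)"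
  proof (rule f.inj_on_iff_eq_0[THEN iffD2, OF complex_vector.subspace_span], intro ballI impI)
    fix x assume x: "x \<in> complex_vector.span ?D" "f x = 0"
    have "x \<in> N" using x(1) complex_vector.span_mono[of ?D B] N_eq by auto
    with x(2) C have xC: "x \<in> complex_vector.span C" by auto
    \<comment> \<open>\<open>g\<close> is the projection along \<open>span C\<close>: it separates the spans of the two parts of the basis.\<close>
    obtain g :: "'a \<Rightarrow> 'a" where g: "clinear g" "\<forall>b\<in>B. g b = (if b \<in> C then 0 else b)"
      using Q.linear_independent_extend[OF B(3), of "\<lambda>b. if b \<in> C then 0 else b"] by blast
    interpret g: Vector_Spaces.linear scaleC scaleC g by (rule g(1))
    have "g x = 0"
      using g(1) _ xC by (rule Q.linear_eq_0_on_span) (use g(2) B(1) in auto)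
    moreover have "g x = id x"
      using g(1) complex_vector.linear_id x(1) by (rule Q.linear_eq_on) (use g(2) in auto)
    ultimately show "x = 0" by simp
  qed
  have "f ` N = complex_vector.span (f ` B)"
    unfolding N_eq by (rule P.linear_span_image[OF f, symmetric])
  also have "\<dots> = complex_vector.span (f ` ?D)"
  proof
    have "f b \<in> complex_vector.span (f ` ?D)" if "b \<in> B" for b
    proof (cases "b \<in> C")
      case True
      then have "f b = 0" using C(2) by auto
      then show ?thesis by (simp add: complex_vector.span_zero)
    next
      case False
      then show ?thesis using that by (intro complex_vector.span_base) simp
    qed
    then show "complex_vector.span (f ` B) \<subseteq> complex_vector.span (f ` ?D)"
      by (intro complex_vector.span_minimal) auto
    show "complex_vector.span (f ` ?D) \<subseteq> complex_vector.span (f ` B)"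
      by (intro complex_vector.span_mono) auto
  qed
  also have "\<dots> = f ` complex_vector.span ?D"
    by (rule P.linear_span_image[OF f])
  finally have "cdim (f ` N) = cdim (complex_vector.span ?D)"
    using cdim_image_inj[OF f complex_vector.subspace_span inj] by simp
  also have "\<dots> = enat (card ?D)"
    using finB indD by (intro cdim_span_independent) auto
  finally have "cdim (f ` N) = enat (card ?D)" .
  moreover have "cdim N = enat (card B)"
    unfolding N_eq using finB B(3) by (rule cdim_span_independent)
  moreover have "card B = card C + card ?D"
    using finB B(1) card_mono[OF finB B(1)] by (simp add: card_Diff_subset finite_subset)
  ultimately show ?thesis using C(5) by simp
qed

lemma decseq_subspace_stabilizes:
  fixes V :: "nat \<Rightarrow> 'a::complex_normed_vector set"
  assumes sub: "\<And>n. complex_vector.subspace (V n)" and dec: "decseq V" and fin: "cdim (V 0) < \<infinity>"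
  obtains q where "\<And>n. n \<ge> q \<Longrightarrow> V n = V q"
proof -
  obtain q where q: "\<And>n. cdim (V q) \<le> cdim (V n)"
  proof -
    have "(LEAST d. d \<in> range (\<lambda>n. cdim (V n))) \<in> range (\<lambda>n. cdim (V n))"
      by (rule LeastI[of _ "cdim (V 0)"]) simp
    then obtain q where "(LEAST d. d \<in> range (\<lambda>n. cdim (V n))) = cdim (V q)" by auto
    then show thesis using that[of q] by (metis Least_le rangeI)
  qed
  have "V n = V q" if "n \<ge> q" for n
  proof (rule cdim_eq_imp_eq)
    show "V n \<subseteq> V q" using dec that by (simp add: decseq_def)
    have "V q \<subseteq> V 0" using dec by (simp add: decseq_def)
    then show "cdim (V q) < \<infinity>" using fin by (rule cdim_finite_subset)
  qed (use sub q in auto)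
  then show thesis by (rule that)
qed

section \<open>The open mapping theorem and sums of subspaces\<close>

text \<open>
  The open mapping theorem in the form in which it is used: solutions of \<open>f x = y\<close> in \<open>M\<close> can be chosen of norm
  proportional to that of \<open>y\<close>. By Baire's theorem in the complete space \<open>f ` M\<close>, the closure of the image of
  some ball has an interior point; by homogeneity every \<open>y\<close> is approximated up to half its norm by
  \<open>f x\<close> with controlled \<open>x\<close>, and iterating on the remainder gives an exact solution as a convergent series.
\<close>

lemma open_mapping_closed_range:
  fixes f :: "'a::banach \<Rightarrow> 'b::banach"
  assumes f: "bounded_linear f" and M: "subspace M" "closed M" and N: "closed (f ` M)"
  shows "\<exists>C>0. \<forall>y\<in>f ` M. \<exists>x\<in>M. f x = y \<and> norm x \<le> C * norm y"
proof -
  interpret f: bounded_linear f by (rule f)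
  define A where "A n = closure (f ` (M \<inter> cball 0 (real n)))" for n
  have sN: "subspace (f ` M)"
    using f.linear_axioms M(1) by (rule linear_subspace_image)
  have AN: "A n \<subseteq> f ` M" for n
    unfolding A_def using N by (intro closure_minimal) auto
  have un: "(\<Union>n. A n) = f ` M"
  proof
    show "f ` M \<subseteq> (\<Union>n. A n)"
    proof
      fix y assume "y \<in> f ` M"
      then obtain x where x: "x \<in> M" "y = f x" by auto
      obtain n where "norm x \<le> real n" using real_arch_simple by blast
      then have "y \<in> f ` (M \<inter> cball 0 (real n))" using x by auto
      then have "y \<in> A n" unfolding A_def by (rule subsetD[OF closure_subset])
      then show "y \<in> (\<Union>n. A n)" by blast
    qed
  qed (use AN in auto)
  have "\<exists>n. (top_of_set (f ` M)) interior_of (A n) \<noteq> {}"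
  proof (rule ccontr)
    assume "\<not> ?thesis"
    then have "(top_of_set (f ` M)) interior_of (\<Union>(range A)) = {}"
    proof (intro Baire_category_alt)
      show "completely_metrizable_space (top_of_set (f ` M)) \<or>
          locally_compact_space (top_of_set (f ` M)) \<and> regular_space (top_of_set (f ` M))"
        using N completely_metrizable_space_closedin[OF completely_metrizable_space_euclidean, of "f ` M"]
        by simp
    next
      fix T assume "\<not> (\<exists>n. (top_of_set (f ` M)) interior_of (A n) \<noteq> {})" "T \<in> range A"
      then show "closedin (top_of_set (f ` M)) T \<and> (top_of_set (f ` M)) interior_of T = {}"
        using AN by (force simp: A_def intro: closed_subset)
    qed auto
    moreover have "0 \<in> f ` M" using sN by (rule subspace_0)
    ultimately show False
      using un interior_of_topspace[of "top_of_set (f ` M)"] by (simp del: interior_of_topspace)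
  qed
  then obtain n y0 where "y0 \<in> (top_of_set (f ` M)) interior_of (A n)" by auto
  then obtain U where U: "openin (top_of_set (f ` M)) U" "y0 \<in> U" "U \<subseteq> A n"
    unfolding interior_of_def by auto
  then obtain r where r: "r > 0" "\<And>y. y \<in> f ` M \<Longrightarrow> dist y y0 < r \<Longrightarrow> y \<in> A n"
  proof -
    have "\<exists>e>0. \<forall>x'\<in>f ` M. dist x' y0 < e \<longrightarrow> x' \<in> U"
      using U(1,2) unfolding openin_euclidean_subtopology_iff by blast
    then show thesis using that U(3) by blast
  qed
  have y0: "y0 \<in> f ` M" "y0 \<in> A n" using U AN by auto
  \<comment> \<open>Differences of two points of the closure \<open>A n\<close> fill a neighbourhood of \<open>0\<close>.\<close>
  have appr: "\<exists>x\<in>M. norm x \<le> 2 * real n \<and> norm (y - f x) < e"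
    if y: "y \<in> f ` M" "norm y < r" and e: "e > 0" for y e
  proof -
    have "y0 + y \<in> A n"
      using r(2)[of "y0 + y"] y y0 sN by (simp add: subspace_add dist_norm)
    then obtain u where "u \<in> f ` (M \<inter> cball 0 (real n))" "dist u (y0 + y) < e / 2"
      unfolding A_def closure_approachable using e half_gt_zero by blast
    then obtain a where a: "a \<in> M" "norm a \<le> real n" "dist (f a) (y0 + y) < e / 2"
      by auto
    obtain w where "w \<in> f ` (M \<inter> cball 0 (real n))" "dist w y0 < e / 2"
      using y0(2) e half_gt_zero unfolding A_def closure_approachable by blast
    then obtain b where b: "b \<in> M" "norm b \<le> real n" "dist (f b) y0 < e / 2"
      by auto
    have "norm (y - f (a - b)) = norm ((f b - y0) - (f a - (y0 + y)))"
      by (simp add: f.diff algebra_simps)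
    also have "\<dots> \<le> norm (f b - y0) + norm (f a - (y0 + y))" by (rule norm_triangle_ineq4)
    also have "\<dots> < e" using a(3) b(3) by (simp add: dist_norm)
    finally have "norm (y - f (a - b)) < e" .
    moreover have "norm (a - b) \<le> 2 * real n" using norm_triangle_ineq4[of a b] a(2) b(2) by linarith
    moreover have "a - b \<in> M" using M(1) a(1) b(1) by (rule subspace_diff)
    ultimately show ?thesis by blast
  qed
  define K where "K = 4 * real n / r + 1"
  have K: "K > 0" using r(1) by (simp add: K_def add_nonneg_pos)
  have half: "\<exists>x\<in>M. norm x \<le> K * norm y \<and> norm (y - f x) \<le> norm y / 2" if y: "y \<in> f ` M" for y
  proof (cases "y = 0")
    case True
    then show ?thesis using subspace_0[OF M(1)] f.zero by force
  next
    case False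
    define c where "c = r / (2 * norm y)"
    have c: "c > 0" using False r(1) by (simp add: c_def)
    have "norm (c *\<^sub>R y) < r" using False r(1) by (simp add: c_def)
    moreover have "c *\<^sub>R y \<in> f ` M" using y sN by (simp add: subspace_scale)
    moreover have "c * norm y / 2 > 0" using c False by simp
    ultimately obtain x where x: "x \<in> M" "norm x \<le> 2 * real n" "norm (c *\<^sub>R y - f x) < c * norm y / 2"
      using appr by blast
    let ?x = "(1 / c) *\<^sub>R x"
    have "?x \<in> M" using x M(1) by (simp add: subspace_scale)
    moreover have "norm ?x \<le> K * norm y"
    proof -
      have "norm ?x \<le> 2 * real n / c" using c x(2) by (simp add: divide_right_mono)
      also have "\<dots> = 4 * real n / r * norm y" using False r(1) by (simp add: c_def field_simps)
      also have "\<dots> \<le> K * norm y" by (simp add: K_def distrib_right)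
      finally show ?thesis .
    qed
    moreover have "norm (y - f ?x) \<le> norm y / 2"
    proof -
      have "y - f ?x = (1 / c) *\<^sub>R (c *\<^sub>R y - f x)"
        using c by (simp add: f.scaleR scaleR_diff_right)
      then have "norm (y - f ?x) = norm (c *\<^sub>R y - f x) / c" using c by simp
      also have "\<dots> \<le> (c * norm y / 2) / c" using x(3) c by (intro divide_right_mono) auto
      finally show ?thesis using c by simp
    qed
    ultimately show ?thesis by blast
  qed
  then have "\<forall>y\<in>f ` M. \<exists>x. x \<in> M \<and> norm x \<le> K * norm y \<and> norm (y - f x) \<le> norm y / 2" by blast
  then obtain g where "\<forall>y\<in>f ` M. g y \<in> M \<and> norm (g y) \<le> K * norm y \<and> norm (y - f (g y)) \<le> norm y / 2"
    unfolding bchoice_iff by blast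
  then have g: "\<And>y. y \<in> f ` M \<Longrightarrow> g y \<in> M" "\<And>y. y \<in> f ` M \<Longrightarrow> norm (g y) \<le> K * norm y"
    "\<And>y. y \<in> f ` M \<Longrightarrow> norm (y - f (g y)) \<le> norm y / 2"
    by blast+
  have "\<exists>x\<in>M. f x = y \<and> norm x \<le> (2 * K) * norm y" if y: "y \<in> f ` M" for y
  proof -
    \<comment> \<open>\<open>Y k\<close> is the remainder after \<open>k\<close> correction steps.\<close>
    define Y where "Y k = ((\<lambda>y. y - f (g y)) ^^ k) y" for k
    have YS: "Y (Suc k) = Y k - f (g (Y k))" for k by (simp add: Y_def)
    have YN: "Y k \<in> f ` M" for k
    proof (induction k)
      case 0
      then show ?case using y by (simp add: Y_def)
    next
      case (Suc k)
      then show ?case unfolding YS using g(1) sN by (simp add: subspace_diff)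
    qed
    have Ynorm: "norm (Y k) \<le> norm y * (1 / 2) ^ k" for k
    proof (induction k)
      case 0
      then show ?case by (simp add: Y_def)
    next
      case (Suc k)
      have "norm (Y (Suc k)) \<le> norm (Y k) / 2" unfolding YS using g(3) YN by blast
      with Suc show ?case by simp
    qed
    have gnorm: "norm (g (Y k)) \<le> K * norm y * (1 / 2) ^ k" for k
    proof -
      have "norm (g (Y k)) \<le> K * norm (Y k)" using g(2) YN by blast
      also have "\<dots> \<le> K * (norm y * (1 / 2) ^ k)" using Ynorm K by (intro mult_left_mono) auto
      finally show ?thesis by simp
    qed
    have geo: "(\<lambda>k. K * norm y * (1 / 2) ^ k) sums (K * norm y * 2)"
      using geometric_sums[of "1 / 2 :: real"] by (intro sums_mult) auto
    have summ: "summable (\<lambda>k. g (Y k))"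
      using sums_summable[OF geo] gnorm by (rule summable_comparison_test'[where N = 0])
    have summn: "summable (\<lambda>k. norm (g (Y k)))"
      by (rule summable_comparison_test'[where N = 0, OF sums_summable[OF geo]]) (use gnorm in auto)
    let ?x = "\<Sum>k. g (Y k)"
    have "?x \<in> M"
    proof (rule closed_sequentially[OF M(2)])
      show "(\<lambda>n. \<Sum>k<n. g (Y k)) \<longlonglongrightarrow> ?x" using summ by (rule summable_LIMSEQ)
      show "(\<Sum>k<n. g (Y k)) \<in> M" for n using g(1) YN M(1) by (simp add: subspace_sum)
    qed
    moreover have "f ?x = y"
    proof -
      have "(\<lambda>k. f (g (Y k))) sums f ?x" using summ by (intro f.sums summable_sums)
      moreover have "(\<lambda>k. f (g (Y k))) sums y"
      proof -
        have "Y \<longlonglongrightarrow> 0"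
        proof (rule Lim_null_comparison)
          show "\<forall>\<^sub>F k in sequentially. norm (Y k) \<le> norm y * (1 / 2) ^ k" using Ynorm by simp
          show "(\<lambda>k. norm y * (1 / 2) ^ k) \<longlonglongrightarrow> 0"
            using tendsto_mult_left[OF LIMSEQ_power_zero[of "1/2::real"], of "norm y"] by simp
        qed
        then have "(\<lambda>k. Y k - Y (Suc k)) sums (Y 0 - 0)" by (rule telescope_sums')
        then show ?thesis by (simp add: YS) (simp add: Y_def)
      qed
      ultimately show ?thesis by (rule sums_unique2)
    qed
    moreover have "norm ?x \<le> (2 * K) * norm y"
    proof -
      have "norm ?x \<le> (\<Sum>k. norm (g (Y k)))" using summn by (rule summable_norm)
      also have "\<dots> \<le> (\<Sum>k. K * norm y * (1 / 2) ^ k)"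
        using gnorm summn sums_summable[OF geo] by (rule suminf_le)
      also have "\<dots> = K * norm y * 2" using geo by (rule sums_unique[symmetric])
      finally show ?thesis by simp
    qed
    ultimately show ?thesis by blast
  qed
  then show ?thesis using K by (intro exI[of _ "2 * K"]) simp
qed

lemma complex_subspace_imp_subspace:
  "complex_vector.subspace V \<Longrightarrow> subspace V"
  by (auto simp: complex_vector.subspace_def subspace_def scaleR_scaleC)

text \<open>
  If \<open>b\<close> has distance \<open>d > 0\<close> from \<open>V\<close>, then \<open>d |c| \<le> \<parallel>v + c b\<parallel>\<close>, so along a convergent sequence in
  \<open>V + \<complex>b\<close> the coefficients \<open>c\<close> converge.
\<close>

lemma closed_subspace_plus_line:
  fixes V :: "'a::complex_banach set"
  assumes V: "complex_vector.subspace V" and cl: "closed V"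
  shows "closed {v + c *\<^sub>C b | v c. v \<in> V}"
proof (cases "b \<in> V")
  case True
  have "{v + c *\<^sub>C b | v c. v \<in> V} = V"
  proof
    show "V \<subseteq> {v + c *\<^sub>C b | v c. v \<in> V}"
    proof
      fix v assume "v \<in> V"
      moreover have "v = v + 0 *\<^sub>C b" by simp
      ultimately show "v \<in> {v + c *\<^sub>C b | v c. v \<in> V}" by blast
    qed
  qed (use True V in \<open>auto simp: complex_vector.subspace_add complex_vector.subspace_scale\<close>)
  with cl show ?thesis by simp
next
  case False
  obtain d where d: "d > 0" "\<And>v. v \<in> V \<Longrightarrow> d \<le> norm (b - v)"
  proof -
    obtain d where "d > 0" "ball b d \<subseteq> - V"
      using False cl open_contains_ball[of "- V"] by auto
    then show thesis using that[of d] by (auto simp: dist_norm subset_iff not_less[symmetric])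
  qed
  have est: "d * cmod c \<le> norm (v + c *\<^sub>C b)" if "v \<in> V" for v c
  proof (cases "c = 0")
    case False
    have "v + c *\<^sub>C b = c *\<^sub>C (b - (- (1 / c)) *\<^sub>C v)"
      using False by (simp add: complex_vector.scale_right_distrib)
    then have "norm (v + c *\<^sub>C b) = cmod c * norm (b - (- (1 / c)) *\<^sub>C v)"
      by (metis norm_scaleC)
    also have "\<dots> \<ge> cmod c * d"
      using V that by (intro mult_left_mono d) (auto simp: complex_vector.subspace_scale complex_vector.subspace_neg)
    finally show ?thesis by (simp add: mult.commute)
  qed simp
  show ?thesis
    unfolding closed_sequential_limits
  proof (intro allI impI, elim conjE)
    fix x l assume x: "\<forall>n. x n \<in> {v + c *\<^sub>C b | v c. v \<in> V}" and lim: "x \<longlonglongrightarrow> l"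
    from x have "\<forall>n. \<exists>v c. v \<in> V \<and> x n = v + c *\<^sub>C b" by blast
    then obtain v c where vc: "\<And>n. v n \<in> V" "\<And>n. x n = v n + c n *\<^sub>C b"
      by (auto simp only: choice_iff)
    have "Cauchy c"
    proof (rule CauchyI)
      fix e :: real assume "e > 0"
      then have "d * e > 0" using d(1) by simp
      then obtain M where M: "\<And>m n. m \<ge> M \<Longrightarrow> n \<ge> M \<Longrightarrow> norm (x m - x n) < d * e"
        using LIMSEQ_imp_Cauchy[OF lim] CauchyD by blast
      have "norm (c m - c n) < e" if "m \<ge> M" "n \<ge> M" for m n
      proof -
        have "x m - x n = (v m - v n) + (c m - c n) *\<^sub>C b"
          by (simp add: vc(2) complex_vector.scale_left_diff_distrib)
        moreover have "v m - v n \<in> V" using V vc(1) by (simp add: complex_vector.subspace_diff)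
        ultimately have "d * cmod (c m - c n) \<le> norm (x m - x n)" using est by simp
        also have "\<dots> < d * e" using M that by blast
        finally show ?thesis using d(1) by simp
      qed
      then show "\<exists>M. \<forall>m\<ge>M. \<forall>n\<ge>M. norm (c m - c n) < e" by blast
    qed
    then obtain k where k: "c \<longlonglongrightarrow> k" using Cauchy_convergent convergent_def by blast
    have "(\<lambda>n. c n *\<^sub>C b) \<longlonglongrightarrow> k *\<^sub>C b"
    proof (rule LIM_zero_cancel, rule Lim_null_comparison)
      show "\<forall>\<^sub>F n in sequentially. norm (c n *\<^sub>C b - k *\<^sub>C b) \<le> norm (c n - k) * norm b"
        by (simp add: norm_scaleC flip: complex_vector.scale_left_diff_distrib)
      show "(\<lambda>n. norm (c n - k) * norm b) \<longlonglongrightarrow> 0"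
        using tendsto_mult_right[OF tendsto_norm_zero[OF LIM_zero[OF k]], of "norm b"] by simp
    qed
    from tendsto_diff[OF lim this] have "v \<longlonglongrightarrow> l - k *\<^sub>C b" by (simp add: vc(2))
    then have "l - k *\<^sub>C b \<in> V" using cl vc(1) closed_sequentially by blast
    moreover have "l = (l - k *\<^sub>C b) + k *\<^sub>C b" by simp
    ultimately show "l \<in> {v + c *\<^sub>C b | v c. v \<in> V}" by blast
  qed
qed

lemma closed_subspace_plus_finite_dim:
  fixes V :: "'a::complex_banach set"
  assumes V: "complex_vector.subspace V" "closed V"
    and F: "complex_vector.subspace F" "cdim F < \<infinity>"
  shows "closed {v + w | v w. v \<in> V \<and> w \<in> F}"
proof -
  have "closed {v + w | v w. v \<in> V \<and> w \<in> complex_vector.span B}" if "finite B" for B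
    using that
  proof (induction B)
    case empty
    then show ?case using V by simp
  next
    case (insert b B)
    let ?W = "{v + w | v w. v \<in> V \<and> w \<in> complex_vector.span B}"
    have "complex_vector.subspace ?W"
      using V(1) by (intro complex_vector.subspace_sums) auto
    then have "closed {v + c *\<^sub>C b | v c. v \<in> ?W}"
      using insert.IH by (rule closed_subspace_plus_line)
    also have "{v + c *\<^sub>C b | v c. v \<in> ?W} = {v + w | v w. v \<in> V \<and> w \<in> complex_vector.span (insert b B)}"
    proof (intro subset_antisym subsetI)
      fix x assume "x \<in> {v + c *\<^sub>C b | v c. v \<in> ?W}"
      then obtain v w c where *: "v \<in> V" "w \<in> complex_vector.span B" "x = (v + w) + c *\<^sub>C b" by blast
      then have "w + c *\<^sub>C b \<in> complex_vector.span (insert b B)"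
        by (auto simp: complex_vector.span_insert intro!: exI[of _ c])
      moreover have "x = v + (w + c *\<^sub>C b)" using * by (simp add: algebra_simps)
      ultimately show "x \<in> {v + w | v w. v \<in> V \<and> w \<in> complex_vector.span (insert b B)}"
        using *(1) by blast
    next
      fix x assume "x \<in> {v + w | v w. v \<in> V \<and> w \<in> complex_vector.span (insert b B)}"
      then obtain v w c where *: "v \<in> V" "w - c *\<^sub>C b \<in> complex_vector.span B" "x = v + w"
        by (auto simp: complex_vector.span_insert)
      then have "v + (w - c *\<^sub>C b) \<in> ?W" by blast
      moreover have "x = (v + (w - c *\<^sub>C b)) + c *\<^sub>C b" using * by simp
      ultimately show "x \<in> {v + c *\<^sub>C b | v c. v \<in> ?W}" by blast
    qed
    finally show ?case .
  qed
  moreover obtain B where "finite B" "F = complex_vector.span B"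
    using cdim_finite_basis[OF F(2)] F(1) by (metis complex_vector.span_subspace)
  ultimately show ?thesis by simp
qed

lemma closed_finite_dim:
  fixes F :: "'a::complex_banach set"
  assumes F: "complex_vector.subspace F" "cdim F < \<infinity>"
  shows "closed F"
  using closed_subspace_plus_finite_dim[OF complex_vector.subspace_single_0 closed_singleton F] by simp

section \<open>The Hahn-Banach theorem\<close>

text \<open>
  Partial functionals are represented by their graphs: a linear subspace of the product that lies below \<open>K\<close> times
  the norm is automatically single-valued. A value \<open>c\<close> at \<open>x0\<close> is admissible iff it separates all
  \<open>a - K \<parallel>x - x0\<parallel>\<close> from all \<open>K \<parallel>y + x0\<parallel> - b\<close>, and the triangle inequality leaves room for one.
\<close>

lemma hahn_banach_one_step:
  fixes G :: "('a::real_normed_vector \<times> real) set"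
  assumes G: "subspace G" and le: "\<And>x a. (x, a) \<in> G \<Longrightarrow> a \<le> K * norm x" and K: "K \<ge> 0"
  shows "\<exists>c G'. subspace G' \<and> G \<subseteq> G' \<and> (x0, c) \<in> G' \<and> (\<forall>(x, a)\<in>G'. a \<le> K * norm x)"
proof -
  have zero: "(0, 0) \<in> G" using subspace_0[OF G] by (simp add: zero_prod_def)
  let ?L = "(\<lambda>(x, a). a - K * norm (x - x0)) ` G"
  have sep: "a - K * norm (x - x0) \<le> K * norm (y + x0) - b" if "(x, a) \<in> G" "(y, b) \<in> G" for x a y b
  proof -
    have "(x + y, a + b) \<in> G" using subspace_add[OF G that] by simp
    then have "a + b \<le> K * norm ((x - x0) + (y + x0))" using le by simp
    also have "\<dots> \<le> K * (norm (x - x0) + norm (y + x0))"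
      using K norm_triangle_ineq[of "x - x0" "y + x0"] by (intro mult_left_mono) auto
    finally show ?thesis by (simp add: algebra_simps)
  qed
  define c where "c = Sup ?L"
  have bdd: "bdd_above ?L"
    using sep[OF _ zero] by (auto intro!: bdd_aboveI[where M = "K * norm x0"])
  have lower: "a - K * norm (x - x0) \<le> c" if "(x, a) \<in> G" for x a
    unfolding c_def using that bdd by (intro cSup_upper) force+
  have upper: "c \<le> K * norm (y + x0) - b" if "(y, b) \<in> G" for y b
    unfolding c_def using sep[OF _ that] zero by (intro cSup_least) auto
  let ?G' = "{p + q | p q. p \<in> G \<and> q \<in> span {(x0, c)}}"
  have "subspace ?G'" using G by (intro subspace_sums) auto
  moreover have "G \<subseteq> ?G'"
  proof
    fix p assume "p \<in> G"
    moreover have "p = p + 0" by simp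
    ultimately show "p \<in> ?G'" using span_zero by blast
  qed
  moreover have "(x0, c) \<in> ?G'"
  proof -
    have "(x0, c) = 0 + (x0, c)" by simp
    then show ?thesis using subspace_0[OF G] span_base[of "(x0, c)" "{(x0, c)}"] by blast
  qed
  moreover have "a + t * c \<le> K * norm (x + t *\<^sub>R x0)" if xa: "(x, a) \<in> G" for x a t
  proof (cases t "0 :: real" rule: linorder_cases)
    case equal
    then show ?thesis using le[OF xa] by simp
  next
    case greater
    have "(x /\<^sub>R t, a / t) \<in> G"
      using subspace_scale[OF G xa, of "1 / t"] by (simp add: divide_inverse_commute)
    from upper[OF this] have "t * c \<le> t * (K * norm (x /\<^sub>R t + x0) - a / t)"
      using greater by (intro mult_left_mono) auto
    also have "\<dots> = K * (\<bar>t\<bar> * norm (x /\<^sub>R t + x0)) - a"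
      using greater by (simp add: algebra_simps)
    also have "\<bar>t\<bar> * norm (x /\<^sub>R t + x0) = norm (x + t *\<^sub>R x0)"
      using greater norm_scaleR[of t "x /\<^sub>R t + x0"] by (simp add: scaleR_add_right)
    finally show ?thesis by simp
  next
    case less
    define s where "s = - t"
    have s: "s > 0" using less by (simp add: s_def)
    have "(x /\<^sub>R s, a / s) \<in> G"
      using subspace_scale[OF G xa, of "1 / s"] by (simp add: divide_inverse_commute)
    from lower[OF this] have "s * (a / s - K * norm (x /\<^sub>R s - x0)) \<le> s * c"
      using s by (intro mult_left_mono) auto
    also have "s * (a / s - K * norm (x /\<^sub>R s - x0)) = a - K * (\<bar>s\<bar> * norm (x /\<^sub>R s - x0))"
      using s by (simp add: algebra_simps)
    also have "\<bar>s\<bar> * norm (x /\<^sub>R s - x0) = norm (x - s *\<^sub>R x0)"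
      using s norm_scaleR[of s "x /\<^sub>R s - x0"] by (simp add: scaleR_diff_right)
    finally show ?thesis by (simp add: s_def)
  qed
  then have "\<forall>(x, a)\<in>?G'. a \<le> K * norm x"
    by (auto simp: span_singleton)
  ultimately show ?thesis by blast
qed

lemma hahn_banach_real:
  fixes G :: "('a::real_normed_vector \<times> real) set"
  assumes G: "subspace G" and le: "\<And>x a. (x, a) \<in> G \<Longrightarrow> a \<le> K * norm x" and K: "K \<ge> 0"
  obtains g where "linear g" "\<And>x. g x \<le> K * norm x" "\<And>x a. (x, a) \<in> G \<Longrightarrow> g x = a"
proof -
  define \<E> where "\<E> = {H. subspace H \<and> G \<subseteq> H \<and> (\<forall>(x, a)\<in>H. a \<le> K * norm x)}"
  have "\<exists>M\<in>\<E>. \<forall>H\<in>\<E>. M \<subseteq> H \<longrightarrow> H = M"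
  proof (rule subset_Zorn_nonempty)
    show "\<E> \<noteq> {}" using G le by (auto simp: \<E>_def)
    fix \<C> assume ne: "\<C> \<noteq> {}" and "subset.chain \<E> \<C>"
    then have C: "\<And>H. H \<in> \<C> \<Longrightarrow> H \<in> \<E>" and ch: "\<And>H H'. H \<in> \<C> \<Longrightarrow> H' \<in> \<C> \<Longrightarrow> H \<subseteq> H' \<or> H' \<subseteq> H"
      by (auto simp: subset_chain_def)
    have "subspace (\<Union>\<C>)"
      unfolding subspace_def
    proof (intro conjI ballI allI)
      show "0 \<in> \<Union>\<C>" using ne C by (auto simp: \<E>_def subspace_0)
      fix p assume "p \<in> \<Union>\<C>"
      then obtain H where H: "H \<in> \<C>" "p \<in> H" by auto
      then show "c *\<^sub>R p \<in> \<Union>\<C>" for c using C[OF H(1)] H(1) by (auto simp: \<E>_def intro!: bexI[of _ H] subspace_scale)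
      fix q assume "q \<in> \<Union>\<C>"
      then obtain H' where H': "H' \<in> \<C>" "q \<in> H'" by auto
      obtain H'' where "H'' \<in> \<C>" "p \<in> H''" "q \<in> H''" using ch[OF H(1) H'(1)] H H' by blast
      then show "p + q \<in> \<Union>\<C>" using C[of H''] by (auto simp: \<E>_def intro!: bexI[of _ H''] subspace_add)
    qed
    then show "\<Union>\<C> \<in> \<E>" using ne C unfolding \<E>_def by blast
  qed
  then obtain M where "M \<in> \<E>" and max: "\<And>H. H \<in> \<E> \<Longrightarrow> M \<subseteq> H \<Longrightarrow> H = M" by blast
  then have M: "subspace M" "G \<subseteq> M" and Mle: "\<And>x a. (x, a) \<in> M \<Longrightarrow> a \<le> K * norm x"
    by (auto simp: \<E>_def)
  have total: "\<exists>a. (x, a) \<in> M" for x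
  proof -
    obtain c G' where G': "subspace G'" "M \<subseteq> G'" "(x, c) \<in> G'" "\<forall>(x, a)\<in>G'. a \<le> K * norm x"
      using hahn_banach_one_step[OF M(1) Mle K] by blast
    then have "G' = M" using max M(2) by (auto simp: \<E>_def)
    then show ?thesis using G'(3) by blast
  qed
  have uniq: "a = b" if "(x, a) \<in> M" "(x, b) \<in> M" for x a b
  proof (rule antisym)
    show "a \<le> b" using Mle[of 0 "a - b"] subspace_diff[OF M(1) that] by simp
    show "b \<le> a" using Mle[of 0 "b - a"] subspace_diff[OF M(1) that(2,1)] by simp
  qed
  from total obtain g where g: "\<And>x. (x, g x) \<in> M" by metis
  have "linear g"
  proof (rule linearI)
    show "g (x + y) = g x + g y" for x y
      using subspace_add[OF M(1) g[of x] g[of y]] by (intro uniq[OF g]) simp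
    show "g (r *\<^sub>R x) = r *\<^sub>R g x" for r x
      using subspace_scale[OF M(1) g[of x], of r] by (intro uniq[OF g]) simp
  qed
  moreover have "g x = a" if "(x, a) \<in> G" for x a
    using uniq[OF g] that M(2) by blast
  ultimately show thesis using that[of g] Mle g by blast
qed

lemma ex_cdual:
  fixes h :: "'a::complex_normed_vector \<Rightarrow> complex"
  assumes add: "\<And>x y. h (x + y) = h x + h y" and scale: "\<And>c x. h (c *\<^sub>C x) = c * h x"
    and bound: "\<And>x. cmod (h x) \<le> K * norm x" and K: "K \<ge> 0"
  obtains g where "\<And>x. cdual_apply g x = h x" "norm g \<le> K"
proof -
  have bl: "bounded_linear h"
    by (rule bounded_linear_intro[where K = K])
      (use add scale bound in \<open>auto simp: scaleR_scaleC scaleR_conv_of_real mult.commute\<close>)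
  then have "Blinfun h \<in> {f. \<forall>c x. blinfun_apply f (c *\<^sub>C x) = c * blinfun_apply f x}"
    by (simp add: bounded_linear_Blinfun_apply scale)
  then have app: "cdual_apply (Abs_cdual (Blinfun h)) x = h x" for x
    using bl by (simp add: cdual_apply.rep_eq Abs_cdual_inverse bounded_linear_Blinfun_apply)
  have "norm (Abs_cdual (Blinfun h)) \<le> K"
    unfolding norm_cdual_eq_onorm using app bound K by (intro onorm_bound) auto
  with app show thesis by (rule that)
qed

text \<open>
  The real part of the functional is extended as a real functional \<open>g\<close>; a complex linear functional
  is recovered from its real part as \<open>g x - \<i> g (\<i> x)\<close>, and turning the value at a point to the positive
  axis shows that the bound is the same.
\<close>

lemma hahn_banach_complex:
  fixes G :: "('a::complex_normed_vector \<times> complex) set"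
  assumes zero: "(0, 0) \<in> G"
    and add: "\<And>x a y b. (x, a) \<in> G \<Longrightarrow> (y, b) \<in> G \<Longrightarrow> (x + y, a + b) \<in> G"
    and scale: "\<And>c x a. (x, a) \<in> G \<Longrightarrow> (c *\<^sub>C x, c * a) \<in> G"
    and le: "\<And>x a. (x, a) \<in> G \<Longrightarrow> cmod a \<le> K * norm x" and K: "K \<ge> 0"
  obtains g where "\<And>x a. (x, a) \<in> G \<Longrightarrow> cdual_apply g x = a" "norm g \<le> K"
proof -
  let ?R = "(\<lambda>(x, a). (x, Re a)) ` G"
  have "subspace ?R"
    unfolding subspace_def
  proof (intro conjI ballI allI)
    show "0 \<in> ?R" using zero by (force simp: zero_prod_def)
    fix p assume "p \<in> ?R"
    then obtain x a where p: "(x, a) \<in> G" "p = (x, Re a)" by auto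
    show "r *\<^sub>R p \<in> ?R" for r
      using scale[OF p(1), of "complex_of_real r"] p(2) by (force simp: scaleR_scaleC)
    fix q assume "q \<in> ?R"
    then obtain y b where q: "(y, b) \<in> G" "q = (y, Re b)" by auto
    show "p + q \<in> ?R" using add[OF p(1) q(1)] p(2) q(2) by force
  qed
  moreover have "a \<le> K * norm x" if "(x, a) \<in> ?R" for x a
    using that le complex_Re_le_cmod by (auto intro: order_trans)
  ultimately obtain g where g: "linear g" "\<And>x. g x \<le> K * norm x" "\<And>x a. (x, a) \<in> ?R \<Longrightarrow> g x = a"
    using hahn_banach_real[OF _ _ K] by blast
  interpret g: linear g by (rule g(1))
  define h where "h x = Complex (g x) (- g (\<i> *\<^sub>C x))" for x
  have hadd: "h (x + y) = h x + h y" for x y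
    by (simp add: h_def complex_eq_iff g.add scaleC_add_right)
  have hR: "h (r *\<^sub>R x) = complex_of_real r * h x" for r x
  proof -
    have "\<i> *\<^sub>C r *\<^sub>R x = r *\<^sub>R \<i> *\<^sub>C x"
      by (simp add: scaleR_scaleC scaleC_scaleC mult.commute)
    then show ?thesis by (simp add: h_def complex_eq_iff g.scale)
  qed
  have hi: "h (\<i> *\<^sub>C x) = \<i> * h x" for x
    by (simp add: h_def complex_eq_iff scaleC_scaleC g.neg)
  have hscale: "h (c *\<^sub>C x) = c * h x" for c x
  proof -
    have "c *\<^sub>C x = Re c *\<^sub>R x + Im c *\<^sub>R \<i> *\<^sub>C x"
      by (metis complex_eq mult.commute scaleC_add_left scaleC_scaleC scaleR_scaleC)
    then have "h (c *\<^sub>C x) = (complex_of_real (Re c) + complex_of_real (Im c) * \<i>) * h x"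
      by (simp only: hadd hR hi) (simp add: algebra_simps)
    also have "complex_of_real (Re c) + complex_of_real (Im c) * \<i> = c"
      using complex_eq[of c] by (simp add: mult.commute)
    finally show ?thesis .
  qed
  have "cmod (h x) \<le> K * norm x" for x
  proof (cases "h x = 0")
    case False
    define c where "c = cnj (h x) / complex_of_real (cmod (h x))"
    have c: "cmod c = 1" using False by (simp add: c_def norm_divide)
    have "h (c *\<^sub>C x) = complex_of_real (cmod (h x))"
      using False by (simp add: hscale c_def complex_norm_square[symmetric] power2_eq_square mult.commute)
    then have "cmod (h x) = Re (h (c *\<^sub>C x))" by simp
    also have "\<dots> \<le> K * norm (c *\<^sub>C x)" by (simp add: h_def g(2))
    finally show ?thesis using c by (simp add: norm_scaleC)
  qed (use K in simp)
  then obtain f where f: "\<And>x. cdual_apply f x = h x" "norm f \<le> K"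
    using ex_cdual[of h K] hadd hscale K by blast
  have "cdual_apply f x = a" if "(x, a) \<in> G" for x a
  proof -
    have "g x = Re a" using that by (intro g(3)) force
    moreover have "g (\<i> *\<^sub>C x) = - Im a" using scale[OF that, of \<i>] by (intro g(3)) force
    ultimately show ?thesis by (simp add: f h_def complex_eq_iff)
  qed
  with f(2) show thesis by (rule that[rotated])
qed

text \<open>
  On \<open>V + \<complex>x\<close> the coefficient of \<open>x\<close> is a functional bounded by the inverse of the distance from \<open>x\<close> to \<open>V\<close>.
\<close>

lemma ex_cdual_annihilating:
  fixes V :: "'a::complex_normed_vector set"
  assumes V: "complex_vector.subspace V" "closed V" and x: "x \<notin> V"
  shows "\<exists>g. cdual_apply g x = 1 \<and> (\<forall>v\<in>V. cdual_apply g v = 0)"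
proof -
  have "\<exists>d>0. ball x d \<subseteq> - V"
    using x V(2) open_contains_ball[of "- V"] by auto
  then obtain d where d: "d > 0" "\<And>v. v \<in> V \<Longrightarrow> d \<le> norm (x - v)"
    by (auto simp: dist_norm subset_iff not_less[symmetric])
  let ?G = "{(v + c *\<^sub>C x, c) | v c. v \<in> V}"
  have 1: "(0, 0) \<in> ?G" using V(1) by (auto intro!: exI[of _ 0] complex_vector.subspace_0)
  have 2: "(y + z, a + b) \<in> ?G" if ya: "(y, a) \<in> ?G" and zb: "(z, b) \<in> ?G" for y a z b
  proof -
    obtain v where v: "v \<in> V" "y = v + a *\<^sub>C x" using ya by auto
    obtain w where w: "w \<in> V" "z = w + b *\<^sub>C x" using zb by auto
    have "y + z = (v + w) + (a + b) *\<^sub>C x" using v w by (simp add: scaleC_add_left)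
    moreover have "v + w \<in> V" using V(1) v w by (simp add: complex_vector.subspace_add)
    ultimately show ?thesis by blast
  qed
  have 3: "(c *\<^sub>C y, c * a) \<in> ?G" if ya: "(y, a) \<in> ?G" for c y a
  proof -
    obtain v where v: "v \<in> V" "y = v + a *\<^sub>C x" using ya by auto
    have "c *\<^sub>C y = c *\<^sub>C v + (c * a) *\<^sub>C x" using v by (simp add: scaleC_add_right scaleC_scaleC)
    moreover have "c *\<^sub>C v \<in> V" using V(1) v by (simp add: complex_vector.subspace_scale)
    ultimately show ?thesis by blast
  qed
  have 4: "cmod a \<le> (1 / d) * norm y" if ya: "(y, a) \<in> ?G" for y a
  proof (cases "a = 0")
    case True
    then show ?thesis using d(1) by simp
  next
    case False
    obtain v where v: "v \<in> V" "y = v + a *\<^sub>C x" using ya by auto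
    then have "y = a *\<^sub>C (x - (- (1 / a)) *\<^sub>C v)"
      using False by (simp add: complex_vector.scale_right_distrib)
    then have "norm y = cmod a * norm (x - (- (1 / a)) *\<^sub>C v)" by (metis norm_scaleC)
    also have "\<dots> \<ge> cmod a * d"
      using V(1) v by (intro mult_left_mono d) (auto simp: complex_vector.subspace_scale complex_vector.subspace_neg)
    finally show ?thesis using d(1) by (simp add: field_simps)
  qed
  obtain g where g: "\<And>y a. (y, a) \<in> ?G \<Longrightarrow> cdual_apply g y = a"
  proof (rule hahn_banach_complex[of ?G "1 / d"])
    show "(y + z, a + b) \<in> ?G" if "(y, a) \<in> ?G" "(z, b) \<in> ?G" for y a z b
      using that by (rule 2)
    show "(c *\<^sub>C y, c * a) \<in> ?G" if "(y, a) \<in> ?G" for c y a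
      using that by (rule 3)
    show "cmod a \<le> (1 / d) * norm y" if "(y, a) \<in> ?G" for y a
      using that by (rule 4)
    show thesis if "\<And>y a. (y, a) \<in> ?G \<Longrightarrow> cdual_apply g y = a" for g
      using that by (rule \<open>\<And>g. (\<And>y a. (y, a) \<in> ?G \<Longrightarrow> cdual_apply g y = a) \<Longrightarrow> thesis\<close>)
  qed (use 1 d(1) in simp_all)
  have "cdual_apply g x = 1"
    using V(1) by (intro g) (auto intro!: exI[of _ 0] complex_vector.subspace_0)
  moreover have "cdual_apply g v = 0" if "v \<in> V" for v
    using that by (intro g) (auto intro!: exI[of _ v] exI[of _ 0])
  ultimately show ?thesis by blast
qed

section \<open>Ascent, descent, nullity and deficiency\<close>

lemma bounded_clinear_imp_clinear: "bounded_clinear S \<Longrightarrow> clinear S"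
  by (simp add: bounded_clinear_def Vector_Spaces.linear_iff complex_vector.vector_space_axioms
      linear_add bounded_linear.linear)

lemma clinear_funpow:
  fixes S :: "'a::complex_normed_vector \<Rightarrow> 'a"
  assumes "clinear S"
  shows "clinear (S ^^ n)"
  using assms by (induction n) (auto simp: Vector_Spaces.linear_iff complex_vector.vector_space_axioms)

lemma subspace_null_space:
  assumes "clinear S"
  shows "complex_vector.subspace (null_space S)"
proof -
  interpret S: Vector_Spaces.linear scaleC scaleC S by (rule assms)
  show ?thesis unfolding null_space_def by (rule S.subspace_kernel)
qed

lemma subspace_range:
  fixes S :: "'a::complex_normed_vector \<Rightarrow> 'a"
  assumes "clinear S"
  shows "complex_vector.subspace (range S)"
proof -
  interpret S: Vector_Spaces.linear scaleC scaleC S by (rule assms)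
  show ?thesis using complex_vector.subspace_UNIV by (rule S.subspace_image)
qed

lemma null_space_funpow_mono:
  fixes S :: "'a::complex_normed_vector \<Rightarrow> 'a"
  assumes S: "clinear S" and "m \<le> n"
  shows "null_space (S ^^ m) \<subseteq> null_space (S ^^ n)"
proof -
  interpret p: Vector_Spaces.linear scaleC scaleC "S ^^ (n - m)" by (rule clinear_funpow[OF S])
  have "(S ^^ n) x = (S ^^ (n - m)) ((S ^^ m) x)" for x
    using assms(2) by (metis comp_apply funpow_add le_add_diff_inverse2)
  then show ?thesis by (auto simp: null_space_def p.zero)
qed

lemma cdim_finite_if_kernel_image_finite:
  fixes f :: "'a::complex_normed_vector \<Rightarrow> 'b::complex_normed_vector"
  assumes f: "clinear f" and N: "complex_vector.subspace N"
    and ker: "cdim (N \<inter> {x. f x = 0}) < \<infinity>" and img: "cdim (f ` N) < \<infinity>"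
  shows "cdim N < \<infinity>"
proof -
  interpret f: Vector_Spaces.linear scaleC scaleC f by (rule f)
  interpret P: vector_space_pair "scaleC :: complex \<Rightarrow> 'a \<Rightarrow> 'a" "scaleC :: complex \<Rightarrow> 'b \<Rightarrow> 'b" ..
  obtain C where C: "finite C" "N \<inter> {x. f x = 0} \<subseteq> complex_vector.span C"
    using ker cdim_finite_iff by blast
  obtain B where B: "finite B" "B \<subseteq> f ` N" "f ` N \<subseteq> complex_vector.span B"
    using img by (rule cdim_finite_basis)
  obtain D where D: "finite D" "D \<subseteq> N" "B = f ` D"
    using finite_subset_image[OF B(1,2)] by auto
  have "x \<in> complex_vector.span (C \<union> D)" if x: "x \<in> N" for x
  proof -
    have "f x \<in> f ` complex_vector.span D"
      using x B(3) D(3) P.linear_span_image[OF f, of D] by auto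
    then obtain y where y: "y \<in> complex_vector.span D" "f x = f y" by auto
    have "y \<in> N" using y(1) complex_vector.span_minimal[OF D(2) N] by auto
    then have "x - y \<in> complex_vector.span C"
      using C(2) x y(2) N by (auto simp: f.diff complex_vector.subspace_diff)
    then have "x - y \<in> complex_vector.span (C \<union> D)" "y \<in> complex_vector.span (C \<union> D)"
      using y(1) complex_vector.span_mono[of C "C \<union> D"] complex_vector.span_mono[of D "C \<union> D"] by auto
    then have "(x - y) + y \<in> complex_vector.span (C \<union> D)" by (rule complex_vector.span_add)
    then show ?thesis by simp
  qed
  then show ?thesis unfolding cdim_finite_iff using C(1) D(1) by blast
qed

lemma cdim_null_space_funpow_finite:
  assumes S: "clinear S" and fin: "nullity S < \<infinity>"
  shows "cdim (null_space (S ^^ n)) < \<infinity>"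
proof (induction n)
  case 0
  then show ?case unfolding cdim_finite_iff by (intro exI[of _ "{}"]) (simp add: null_space_def)
next
  case (Suc n)
  show ?case
  proof (rule cdim_finite_if_kernel_image_finite[OF S])
    show "complex_vector.subspace (null_space (S ^^ Suc n))"
      by (intro subspace_null_space clinear_funpow S)
    show "cdim (null_space (S ^^ Suc n) \<inter> {x. S x = 0}) < \<infinity>"
      using fin unfolding nullity_def by (rule cdim_finite_subset[rotated]) (auto simp: null_space_def)
    show "cdim (S ` null_space (S ^^ Suc n)) < \<infinity>"
      using Suc by (rule cdim_finite_subset[rotated]) (auto simp: null_space_def funpow_swap1)
  qed
qed

lemma Inf_enat_finite_iff: "Inf {enat p | p. P p} < \<infinity> \<longleftrightarrow> (\<exists>p. P p)"
proof
  assume "Inf {enat p | p. P p} < \<infinity>"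
  then show "\<exists>p. P p" unfolding Inf_less_iff by auto
next
  assume "\<exists>p. P p"
  then obtain p where "P p" ..
  then have "Inf {enat p | p. P p} \<le> enat p" by (intro Inf_lower) auto
  then show "Inf {enat p | p. P p} < \<infinity>" by (rule order.strict_trans1) simp
qed

lemma ascent_finite_iff: "ascent S < \<infinity> \<longleftrightarrow> (\<exists>p. null_space (S ^^ p) = null_space (S ^^ Suc p))"
  unfolding ascent_def Inf_enat_finite_iff by simp

lemma descent_finite_iff: "descent S < \<infinity> \<longleftrightarrow> (\<exists>q. range (S ^^ q) = range (S ^^ Suc q))"
  unfolding descent_def Inf_enat_finite_iff by simp

lemma range_funpow_Suc_subset:
  fixes S :: "'a \<Rightarrow> 'a"
  shows "range (S ^^ Suc n) \<subseteq> range (S ^^ n)"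
  by (auto simp: funpow_swap1)

text \<open>
  Finite descent \<open>q\<close> gives \<open>X = R(S\<^sup>k) + N(S\<^sup>q)\<close> for every \<open>k\<close>, because each \<open>S\<^sup>q x\<close> is some \<open>S\<^sup>q S\<^sup>k y\<close>.
\<close>

lemma range_funpow_stable_decomposition:
  fixes S :: "'a::complex_normed_vector \<Rightarrow> 'a"
  assumes S: "clinear S" and q: "range (S ^^ q) = range (S ^^ Suc q)"
  shows "\<exists>y z. x = (S ^^ k) y + z \<and> z \<in> null_space (S ^^ q)"
proof -
  interpret p: Vector_Spaces.linear scaleC scaleC "S ^^ q" by (rule clinear_funpow[OF S])
  have comm: "(S ^^ i) ((S ^^ j) u) = (S ^^ j) ((S ^^ i) u)" for i j u
    by (metis add.commute comp_apply funpow_add)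
  have "\<exists>y. (S ^^ q) x = (S ^^ q) ((S ^^ k) y)"
  proof (induction k)
    case 0
    then show ?case by auto
  next
    case (Suc k)
    then obtain y where y: "(S ^^ q) x = (S ^^ q) ((S ^^ k) y)" by blast
    have "(S ^^ q) y \<in> range (S ^^ Suc q)" unfolding q[symmetric] by (rule rangeI)
    then obtain z where "(S ^^ q) y = (S ^^ Suc q) z" by auto
    then have "(S ^^ q) x = (S ^^ k) ((S ^^ q) (S z))"
      using y comm[of q k y] by (simp add: funpow_swap1)
    also have "\<dots> = (S ^^ q) ((S ^^ Suc k) z)"
      using comm[of k q "S z"] by (simp add: funpow_swap1)
    finally show ?case by blast
  qed
  then obtain y where "(S ^^ q) x = (S ^^ q) ((S ^^ k) y)" ..
  then have "x - (S ^^ k) y \<in> null_space (S ^^ q)" by (simp add: null_space_def p.diff)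
  moreover have "x = (S ^^ k) y + (x - (S ^^ k) y)" by simp
  ultimately show ?thesis by blast
qed

lemma range_funpow_stable_if_decomposition:
  fixes S :: "'a::complex_normed_vector \<Rightarrow> 'a"
  assumes S: "clinear S" and dec: "\<And>x. \<exists>y z. x = S y + z \<and> z \<in> null_space (S ^^ q)"
  shows "range (S ^^ q) = range (S ^^ Suc q)"
proof
  interpret p: Vector_Spaces.linear scaleC scaleC "S ^^ q" by (rule clinear_funpow[OF S])
  show "range (S ^^ q) \<subseteq> range (S ^^ Suc q)"
  proof clarify
    fix x
    obtain y z where "x = S y + z" "z \<in> null_space (S ^^ q)" using dec by blast
    then have "(S ^^ q) x = (S ^^ Suc q) y"
      by (simp add: p.add null_space_def funpow_swap1)
    then show "(S ^^ q) x \<in> range (S ^^ Suc q)" by simp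
  qed
qed (rule range_funpow_Suc_subset)

lemma ex_quotient_map:
  fixes S :: "'a::complex_normed_vector \<Rightarrow> 'a"
  assumes "clinear S"
  obtains p :: "'a \<Rightarrow> 'a" where "clinear p" "{x. p x = 0} = range S" "cdim (range p) = deficiency S"
proof -
  obtain W where W: "ccomplement (range S) W"
    using ex_ccomplement[OF subspace_range[OF assms]] by blast
  obtain p where "clinear p" "{x. p x = 0} = range S" "range p = W"
    using ex_projection[OF subspace_range[OF assms] W] by blast
  then show thesis
    using that ccodim_eq[OF subspace_range[OF assms] W] by (simp add: deficiency_def)
qed

text \<open>
  Rank-nullity on \<open>N\<close>, for \<open>S\<close> and for the quotient map modulo the range of \<open>S\<close>, expresses the
  dimension of \<open>N\<close> in two ways. The number \<open>d\<close> is the dimension of the image of \<open>N\<close> in the quotient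
  by the range of \<open>S\<close>.
\<close>

lemma nullity_deficiency_balance:
  fixes S :: "'a::complex_normed_vector \<Rightarrow> 'a"
  assumes S: "clinear S" and N: "complex_vector.subspace N" "cdim N < \<infinity>" "null_space S \<subseteq> N"
  obtains d where "d \<le> deficiency S" "nullity S + cdim (S ` N) = cdim (N \<inter> range S) + d"
    "(\<And>x. \<exists>y z. x = S y + z \<and> z \<in> N) \<Longrightarrow> d = deficiency S"
proof -
  obtain p :: "'a \<Rightarrow> 'a" where p: "clinear p" "{x. p x = 0} = range S" "cdim (range p) = deficiency S"
    using S by (rule ex_quotient_map)
  interpret p: Vector_Spaces.linear scaleC scaleC p by (rule p(1))
  have "N \<inter> {x. S x = 0} = null_space S" using N(3) by (auto simp: null_space_def)
  then have "cdim N = nullity S + cdim (S ` N)"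
    using rank_nullity[OF S N(1,2)] by (simp add: nullity_def)
  moreover have "cdim N = cdim (N \<inter> range S) + cdim (p ` N)"
    using rank_nullity[OF p(1) N(1,2)] p(2) by simp
  moreover have "cdim (p ` N) \<le> deficiency S"
    unfolding p(3)[symmetric] by (intro cdim_mono) auto
  moreover have "cdim (p ` N) = deficiency S" if "\<And>x. \<exists>y z. x = S y + z \<and> z \<in> N"
  proof -
    have "p x \<in> p ` N" for x
    proof -
      obtain y z where "x = S y + z" "z \<in> N" using \<open>\<And>x. \<exists>y z. x = S y + z \<and> z \<in> N\<close> by blast
      moreover have "p (S y) = 0" using p(2) by auto
      ultimately show ?thesis by (simp add: p.add)
    qed
    then have "p ` N = range p" by auto
    then show ?thesis by (simp add: p(3))
  qed
  ultimately show thesis using that[of "cdim (p ` N)"] by simp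
qed

text \<open>
  For \<open>N = N(S\<^sup>p\<^sup>+\<^sup>1)\<close>, with \<open>p\<close> the ascent, \<open>S y \<in> N\<close> implies \<open>y \<in> N\<close>, so \<open>N \<inter> R(S) = S N\<close> and the
  balance reduces to \<open>\<alpha>(S) = d \<le> \<beta>(S)\<close>.
\<close>

lemma nullity_le_deficiency_if_ascent_finite:
  fixes S :: "'a::complex_normed_vector \<Rightarrow> 'a"
  assumes S: "clinear S" and fin: "nullity S < \<infinity>" and asc: "ascent S < \<infinity>"
  shows "nullity S \<le> deficiency S"
proof -
  obtain p where p: "null_space (S ^^ p) = null_space (S ^^ Suc p)"
    using asc ascent_finite_iff by blast
  let ?N = "null_space (S ^^ Suc p)"
  interpret q: Vector_Spaces.linear scaleC scaleC "S ^^ p" by (rule clinear_funpow[OF S])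
  interpret S: Vector_Spaces.linear scaleC scaleC S by (rule S)
  have N: "complex_vector.subspace ?N" "cdim ?N < \<infinity>" "null_space S \<subseteq> ?N"
    using subspace_null_space[OF clinear_funpow[OF S], of "Suc p"]
      cdim_null_space_funpow_finite[OF S fin, of "Suc p"] null_space_funpow_mono[OF S, of 1 "Suc p"]
    by simp_all
  have "S ` ?N = ?N \<inter> range S"
  proof
    show "S ` ?N \<subseteq> ?N \<inter> range S"
      by (auto simp: null_space_def funpow_swap1) (simp add: S.zero flip: funpow_swap1)
    show "?N \<inter> range S \<subseteq> S ` ?N"
    proof
      fix x assume x: "x \<in> ?N \<inter> range S"
      then obtain y where y: "x = S y" by auto
      have "S y \<in> null_space (S ^^ p)" using x p y by auto
      then have "y \<in> ?N" by (simp add: null_space_def funpow_swap1)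
      then show "x \<in> S ` ?N" using y by blast
    qed
  qed
  moreover have "cdim (S ` ?N) < \<infinity>"
    using \<open>S ` ?N = ?N \<inter> range S\<close> by (intro cdim_finite_subset[OF _ N(2)]) blast
  moreover obtain d where "d \<le> deficiency S" "nullity S + cdim (S ` ?N) = cdim (?N \<inter> range S) + d"
    using S N by (rule nullity_deficiency_balance)
  ultimately show ?thesis
    by (cases "cdim (S ` ?N)"; cases "nullity S"; cases d) auto
qed

text \<open>
  For \<open>N = N(S\<^sup>q\<^sup>+\<^sup>1)\<close>, with \<open>q\<close> the descent, \<open>X = R(S) + N\<close>, so \<open>d = \<beta>(S)\<close> in the balance; then
  \<open>\<alpha>(S) \<le> \<beta>(S)\<close> forces \<open>N \<inter> R(S) = S N\<close>, which says that the chain of null spaces has stopped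
  growing. The exponent \<open>q + 1\<close> makes \<open>N\<close> contain \<open>N(S)\<close> also when \<open>q = 0\<close>.
\<close>

lemma ascent_finite_if_descent_finite:
  fixes S :: "'a::complex_normed_vector \<Rightarrow> 'a"
  assumes S: "clinear S" and fin: "nullity S < \<infinity>" and desc: "descent S < \<infinity>"
    and le: "nullity S \<le> deficiency S"
  shows "ascent S < \<infinity>"
proof -
  obtain q where q: "range (S ^^ q) = range (S ^^ Suc q)"
    using desc descent_finite_iff by blast
  let ?N = "null_space (S ^^ Suc q)"
  interpret S: Vector_Spaces.linear scaleC scaleC S by (rule S)
  have N: "complex_vector.subspace ?N" "cdim ?N < \<infinity>" "null_space S \<subseteq> ?N"
    using subspace_null_space[OF clinear_funpow[OF S], of "Suc q"]
      cdim_null_space_funpow_finite[OF S fin, of "Suc q"] null_space_funpow_mono[OF S, of 1 "Suc q"]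
    by simp_all
  have dec: "\<exists>y z. x = S y + z \<and> z \<in> ?N" for x
    using range_funpow_stable_decomposition[OF S q, of x 1]
      null_space_funpow_mono[OF S, of q "Suc q"] by auto
  have sub: "S ` ?N \<subseteq> ?N \<inter> range S"
    by (auto simp: null_space_def funpow_swap1) (simp add: S.zero flip: funpow_swap1)
  obtain d where "nullity S + cdim (S ` ?N) = cdim (?N \<inter> range S) + d" "d = deficiency S"
    using nullity_deficiency_balance[OF S N] dec by auto
  moreover have "cdim (?N \<inter> range S) < \<infinity>" "cdim (S ` ?N) < \<infinity>"
    by (rule cdim_finite_subset[OF _ N(2)], use sub in blast)+
  ultimately have "cdim (?N \<inter> range S) \<le> cdim (S ` ?N)"
    using le fin by (cases "cdim (?N \<inter> range S)"; cases "cdim (S ` ?N)"; cases "nullity S"; cases "deficiency S") auto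
  then have eq: "S ` ?N = ?N \<inter> range S"
    using sub N(1) \<open>cdim (?N \<inter> range S) < \<infinity>\<close> S.subspace_image by (intro cdim_eq_imp_eq) auto
  have "null_space (S ^^ Suc (Suc q)) \<subseteq> ?N"
  proof
    fix y assume "y \<in> null_space (S ^^ Suc (Suc q))"
    then have "S y \<in> ?N \<inter> range S" by (simp add: null_space_def funpow_swap1)
    then obtain n where n: "n \<in> ?N" "S y = S n" unfolding eq[symmetric] by auto
    then have "y - n \<in> null_space S" by (simp add: null_space_def S.diff)
    then have "y - n \<in> ?N" using N(3) by blast
    then have "(y - n) + n \<in> ?N" using n(1) N(1) by (intro complex_vector.subspace_add)
    then show "y \<in> ?N" by simp
  qed
  then have "?N = null_space (S ^^ Suc (Suc q))"
    using null_space_funpow_mono[OF S, of "Suc q" "Suc (Suc q)"] by auto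
  then show ?thesis using ascent_finite_iff by blast
qed

text \<open>
  All null spaces \<open>N(S\<^sup>m)\<close> lie in \<open>R(S) + N(S\<^sup>q)\<close> for one \<open>q\<close>. The decreasing subspaces
  \<open>N(S) \<inter> R(S\<^sup>n)\<close> of the finite dimensional \<open>N(S)\<close> become constant at some \<open>q\<close>; from then on, if
  \<open>S\<^sup>m\<^sup>+\<^sup>1 u = 0\<close>, then \<open>S\<^sup>m u = S\<^sup>m\<^sup>+\<^sup>1 y\<close> for some \<open>y\<close>, and \<open>u - S y\<close> lies in \<open>N(S\<^sup>m)\<close>.
\<close>

lemma null_space_funpow_absorbed:
  fixes S :: "'a::complex_normed_vector \<Rightarrow> 'a"
  assumes S: "clinear S" and fin: "nullity S < \<infinity>"
  obtains q where "\<And>m u. u \<in> null_space (S ^^ m) \<Longrightarrow> \<exists>x w. u = S x + w \<and> w \<in> null_space (S ^^ q)"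
proof -
  interpret S: Vector_Spaces.linear scaleC scaleC S by (rule S)
  have "decseq (\<lambda>n. null_space S \<inter> range (S ^^ n))"
    using range_funpow_Suc_subset[of _ S] by (intro decseq_SucI) blast
  then obtain q where q: "\<And>n. n \<ge> q \<Longrightarrow> null_space S \<inter> range (S ^^ n) = null_space S \<inter> range (S ^^ q)"
    using S fin by (elim decseq_subspace_stabilizes[rotated])
      (auto simp: nullity_def intro!: complex_vector.subspace_inter subspace_null_space subspace_range clinear_funpow)
  have "\<exists>x w. u = S x + w \<and> w \<in> null_space (S ^^ q)" if "u \<in> null_space (S ^^ m)" for m u
    using that
  proof (induction m arbitrary: u)
    case 0
    then have "u = 0" by (simp add: null_space_def)
    then show ?case
      using complex_vector.subspace_0[OF subspace_null_space[OF clinear_funpow[OF S]]]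
      by (intro exI[of _ 0]) (simp add: S.zero)
  next
    case (Suc m)
    show ?case
    proof (cases "m \<ge> q")
      case True
      interpret m: Vector_Spaces.linear scaleC scaleC "S ^^ m" by (rule clinear_funpow[OF S])
      have "(S ^^ m) u \<in> null_space S \<inter> range (S ^^ m)"
        using Suc.prems by (simp add: null_space_def)
      then have "(S ^^ m) u \<in> null_space S \<inter> range (S ^^ Suc m)"
        using q[of m] q[of "Suc m"] True by simp
      then obtain y where "(S ^^ m) u = (S ^^ Suc m) y" by auto
      then have "u - S y \<in> null_space (S ^^ m)"
        by (simp add: null_space_def m.diff funpow_swap1)
      then obtain x w where "u - S y = S x + w" "w \<in> null_space (S ^^ q)" using Suc.IH by blast
      then have "u = S (x + y) + w \<and> w \<in> null_space (S ^^ q)"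
        by (simp add: S.add algebra_simps)
      then show ?thesis by blast
    next
      case False
      then have "u \<in> null_space (S ^^ q)"
        using null_space_funpow_mono[OF S, of "Suc m" q] Suc.prems by (simp only: subset_iff)
      then show ?thesis by (intro exI[of _ 0] exI[of _ u]) (simp add: S.zero)
    qed
  qed
  then show thesis using that by blast
qed

section \<open>Semi-Fredholm operators and their perturbations\<close>

lemma bounded_clinear_shift:
  assumes "bounded_clinear T"
  shows "bounded_clinear (shift T \<mu>)"
proof -
  have T: "bounded_linear T" "\<And>c x. T (c *\<^sub>C x) = c *\<^sub>C T x"
    using assms by (auto simp: bounded_clinear_def)
  have "bounded_linear (\<lambda>x :: 'a. \<mu> *\<^sub>C x)"
    by (rule bounded_linear_intro[where K = "cmod \<mu>"])
      (simp_all add: scaleC_add_right scaleR_scaleC scaleC_scaleC norm_scaleC mult.commute)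
  then have "bounded_linear (shift T \<mu>)"
    unfolding shift_def by (intro bounded_linear_sub T)
  then show ?thesis
    unfolding bounded_clinear_def
    by (simp add: shift_def T scaleC_scaleC mult.commute complex_vector.scale_right_diff_distrib)
qed

lemma shift_shift: "shift (shift T \<mu>) \<nu> = shift T (\<mu> + \<nu>)"
  by (simp add: shift_def fun_eq_iff scaleC_add_left algebra_simps)

lemma ereal_of_enat_diff_le_0_iff:
  "m < \<infinity> \<Longrightarrow> ereal_of_enat m - ereal_of_enat n \<le> 0 \<longleftrightarrow> m \<le> n"
  by (cases m; cases n) auto

lemma upper_semi_Weyl_iff:
  "upper_semi_Weyl S \<longleftrightarrow> closed (range S) \<and> nullity S < \<infinity> \<and> nullity S \<le> deficiency S"
  unfolding upper_semi_Weyl_def upper_semi_Fredholm_def fredholm_index_def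
  using ereal_of_enat_diff_le_0_iff by blast

lemma bounded_below_iff:
  fixes S :: "'a::complex_normed_vector \<Rightarrow> 'a"
  assumes "clinear S"
  shows "bounded_below S \<longleftrightarrow> closed (range S) \<and> null_space S = {0}"
proof -
  interpret S: Vector_Spaces.linear scaleC scaleC S by (rule assms)
  show ?thesis using S.inj_iff_eq_0 S.zero by (auto simp: bounded_below_def null_space_def)
qed

lemma nullity_eq_0: "null_space S = {0} \<Longrightarrow> nullity S = 0"
  using cdim_span_independent[of "{}"] by (simp add: nullity_def complex_vector.independent_empty zero_enat_def)

text \<open>
  A convergent sequence \<open>S v\<^sub>n \<rightarrow> S x\<close> can, by the open mapping theorem, be corrected by solutions \<open>u\<^sub>n\<close> of
  \<open>S u\<^sub>n = S v\<^sub>n - S x\<close> tending to \<open>0\<close>; then \<open>x + u\<^sub>n\<close> differs from \<open>v\<^sub>n\<close> by an element of the null space,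
  so it stays in \<open>V\<close>.
\<close>

lemma closed_image_subspace_containing_null_space:
  fixes S :: "'a::complex_banach \<Rightarrow> 'a"
  assumes S: "bounded_clinear S" and cl: "closed (range S)"
    and V: "complex_vector.subspace V" "closed V" and null: "null_space S \<subseteq> V"
  shows "closed (S ` V)"
proof -
  interpret S: bounded_linear S using S by (simp add: bounded_clinear_def)
  obtain C where C: "C > 0" "\<forall>y\<in>range S. \<exists>x\<in>UNIV. S x = y \<and> norm x \<le> C * norm y"
    using open_mapping_closed_range[OF S.bounded_linear_axioms subspace_UNIV closed_UNIV cl] by blast
  show ?thesis
    unfolding closed_sequential_limits
  proof (intro allI impI, elim conjE)
    fix Y l assume Y: "\<forall>n. Y n \<in> S ` V" and lim: "Y \<longlonglongrightarrow> l"
    have "l \<in> range S" by (rule closed_sequentially[OF cl _ lim]) (use Y in blast)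
    then obtain x where x: "l = S x" by auto
    from Y have "\<forall>n. \<exists>v. v \<in> V \<and> Y n = S v" by blast
    then obtain v where v: "\<And>n. v n \<in> V" "\<And>n. Y n = S (v n)" by (auto simp only: choice_iff)
    have "\<forall>n. \<exists>u. S u = Y n - l \<and> norm u \<le> C * norm (Y n - l)"
    proof
      fix n
      have "Y n - l = S (v n - x)" by (simp add: v x S.diff)
      then show "\<exists>u. S u = Y n - l \<and> norm u \<le> C * norm (Y n - l)" using C(2) by auto
    qed
    then obtain u where u: "\<And>n. S (u n) = Y n - l" "\<And>n. norm (u n) \<le> C * norm (Y n - l)"
      by (auto simp only: choice_iff)
    have "x + u n \<in> V" for n
    proof -
      have "x + u n - v n \<in> V" using u(1)[of n] null by (auto simp: null_space_def S.diff S.add v x)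
      then have "(x + u n - v n) + v n \<in> V" using v(1) V(1) by (intro complex_vector.subspace_add)
      then show ?thesis by simp
    qed
    moreover have "(\<lambda>n. x + u n) \<longlonglongrightarrow> x + 0"
    proof (intro tendsto_add tendsto_const, rule Lim_null_comparison)
      show "\<forall>\<^sub>F n in sequentially. norm (u n) \<le> C * norm (Y n - l)" using u(2) by simp
      show "(\<lambda>n. C * norm (Y n - l)) \<longlonglongrightarrow> 0"
        using tendsto_mult_left[OF tendsto_norm_zero[OF LIM_zero[OF lim]], of C] by simp
    qed
    ultimately have "x + 0 \<in> V" by (rule closed_sequentially[OF V(2)])
    then have "x \<in> V" by simp
    then show "l \<in> S ` V" using x by blast
  qed
qed

lemma closed_image_subspace:
  fixes S :: "'a::complex_banach \<Rightarrow> 'a"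
  assumes S: "bounded_clinear S" and Fr: "upper_semi_Fredholm S"
    and V: "complex_vector.subspace V" "closed V"
  shows "closed (S ` V)"
proof -
  have cS: "clinear S" using S by (rule bounded_clinear_imp_clinear)
  interpret S: Vector_Spaces.linear scaleC scaleC S by (rule cS)
  let ?W = "{v + w | v w. v \<in> V \<and> w \<in> null_space S}"
  have N: "complex_vector.subspace (null_space S)" using cS by (rule subspace_null_space)
  have "closed ?W"
    using V N Fr by (intro closed_subspace_plus_finite_dim) (auto simp: upper_semi_Fredholm_def nullity_def)
  moreover have "complex_vector.subspace ?W" using V(1) N by (rule complex_vector.subspace_sums)
  moreover have "null_space S \<subseteq> ?W"
  proof
    fix w assume "w \<in> null_space S"
    moreover have "w = 0 + w" by simp
    ultimately show "w \<in> ?W" using complex_vector.subspace_0[OF V(1)] by blast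
  qed
  moreover have "closed (range S)" using Fr by (simp add: upper_semi_Fredholm_def)
  ultimately have "closed (S ` ?W)"
    using closed_image_subspace_containing_null_space[OF S] by blast
  also have "S ` ?W = S ` V"
  proof
    show "S ` ?W \<subseteq> S ` V"
    proof clarify
      fix v w assume "v \<in> V" "w \<in> null_space S"
      then show "S (v + w) \<in> S ` V" by (simp add: null_space_def S.add)
    qed
    show "S ` V \<subseteq> S ` ?W"
    proof
      fix y assume "y \<in> S ` V"
      then obtain v where "v \<in> V" "y = S (v + 0)" by auto
      then show "y \<in> S ` ?W" using complex_vector.subspace_0[OF N] by blast
    qed
  qed
  finally show ?thesis .
qed

lemma closed_range_funpow:
  fixes S :: "'a::complex_banach \<Rightarrow> 'a"
  assumes S: "bounded_clinear S" and Fr: "upper_semi_Fredholm S"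
  shows "closed (range (S ^^ n))"
proof (induction n)
  case (Suc n)
  have "closed (S ` range (S ^^ n))"
    using closed_image_subspace[OF S Fr _ Suc] S
    by (simp add: subspace_range clinear_funpow bounded_clinear_imp_clinear)
  then show ?case by (simp add: image_comp)
qed simp

lemma bounded_clinear_inverse:
  fixes S :: "'a::complex_banach \<Rightarrow> 'a"
  assumes S: "bounded_clinear S" and inj: "inj S" and surj: "surj S"
  shows "\<exists>R. bounded_clinear R \<and> R \<circ> S = id \<and> S \<circ> R = id"
proof -
  interpret S: bounded_linear S using S by (simp add: bounded_clinear_def)
  have SC: "S (c *\<^sub>C x) = c *\<^sub>C S x" for c x using S by (simp add: bounded_clinear_def)
  have "closed (range S)" using surj by simp
  then obtain C where C: "C > 0" "\<forall>y\<in>range S. \<exists>x\<in>UNIV. S x = y \<and> norm x \<le> C * norm y"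
    using open_mapping_closed_range[OF S.bounded_linear_axioms subspace_UNIV closed_UNIV] by blast
  define R where "R = inv S"
  have SR: "S (R y) = y" for y unfolding R_def using surj by (rule surj_f_inv_f)
  have RS: "R (S x) = x" for x unfolding R_def using inj by (rule inv_f_f)
  have "bounded_linear R"
  proof (rule bounded_linear_intro)
    show "R (x + y) = R x + R y" for x y
      using RS[of "R x + R y"] by (simp add: S.add SR)
    show "R (r *\<^sub>R x) = r *\<^sub>R R x" for r x
      using RS[of "r *\<^sub>R R x"] by (simp add: S.scaleR SR)
    show "norm (R y) \<le> norm y * C" for y
    proof -
      obtain x where "S x = y" "norm x \<le> C * norm y" using C(2) surj by (metis UNIV_I)
      then show ?thesis using RS[of x] by (simp add: mult.commute)
    qed
  qed
  moreover have "R (c *\<^sub>C x) = c *\<^sub>C R x" for c x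
    using RS[of "c *\<^sub>C R x"] by (simp add: SC SR)
  ultimately show ?thesis
    using SR RS by (intro exI[of _ R]) (auto simp: bounded_clinear_def fun_eq_iff)
qed

lemma not_in_spectrum_iff:
  fixes T :: "'a::complex_banach \<Rightarrow> 'a"
  assumes T: "bounded_clinear T"
  shows "\<mu> \<notin> spectrum T \<longleftrightarrow> inj (shift T \<mu>) \<and> surj (shift T \<mu>)"
proof
  assume "\<mu> \<notin> spectrum T"
  then obtain R where "R \<circ> shift T \<mu> = id" "shift T \<mu> \<circ> R = id" by (auto simp: spectrum_def)
  then show "inj (shift T \<mu>) \<and> surj (shift T \<mu>)"
    by (metis bij_betw_def o_bij)
next
  assume "inj (shift T \<mu>) \<and> surj (shift T \<mu>)"
  then show "\<mu> \<notin> spectrum T"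
    using bounded_clinear_inverse[OF bounded_clinear_shift[OF T, of \<mu>]] unfolding spectrum_def by blast
qed

text \<open>
  With \<open>p\<close> the ascent, \<open>S\<close> is injective with closed range on \<open>M = R(S\<^sup>p)\<close>, hence bounded below there,
  uniformly also for \<open>S - \<mu>I\<close> with small \<open>\<mu>\<close>. For \<open>\<mu> \<noteq> 0\<close> this extends to the whole space: \<open>S\<^sup>p x\<close> lies in
  \<open>M\<close>, and \<open>S\<^sup>p x - \<mu>\<^sup>p x\<close> is controlled by \<open>(S - \<mu>I) x\<close>. So \<open>S - \<mu>I\<close> is surjective by hypothesis, and
  every \<open>y \<in> M\<close> is the limit of \<open>S x\<^sub>\<mu> = y + \<mu> x\<^sub>\<mu>\<close> as \<open>\<mu> \<rightarrow> 0\<close>, where \<open>x\<^sub>\<mu> \<in> M\<close> stays bounded. Since \<open>S M\<close> is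
  closed, \<open>M = S M\<close>.
\<close>

lemma descent_finite_if_nearby_surjective:
  fixes S :: "'a::complex_banach \<Rightarrow> 'a"
  assumes S: "bounded_clinear S" and Br: "upper_semi_Browder S"
    and surj: "\<And>\<mu>. bounded_below (shift S \<mu>) \<Longrightarrow> surj (shift S \<mu>)"
  shows "descent S < \<infinity>"
proof -
  have cS: "clinear S" using S by (rule bounded_clinear_imp_clinear)
  interpret S: bounded_linear S using S by (simp add: bounded_clinear_def)
  have SC: "S (c *\<^sub>C x) = c *\<^sub>C S x" for c x using S by (simp add: bounded_clinear_def)
  have Fr: "upper_semi_Fredholm S" using Br by (simp add: upper_semi_Browder_def)
  obtain p where p: "null_space (S ^^ p) = null_space (S ^^ Suc p)"
    using Br ascent_finite_iff by (auto simp only: upper_semi_Browder_def)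
  interpret P: Vector_Spaces.linear scaleC scaleC "S ^^ p" by (rule clinear_funpow[OF cS])
  have comm: "shift S \<mu> ((S ^^ n) x) = (S ^^ n) (shift S \<mu> x)" for \<mu> n x
  proof -
    interpret n: Vector_Spaces.linear scaleC scaleC "S ^^ n" by (rule clinear_funpow[OF cS])
    show ?thesis by (simp add: shift_def n.diff n.scale funpow_swap1)
  qed
  let ?M = "range (S ^^ p)"
  have M: "complex_vector.subspace ?M" "closed ?M"
    using cS S Fr by (auto intro: subspace_range clinear_funpow closed_range_funpow simp del: funpow.simps)
  have SM: "S ` ?M = range (S ^^ Suc p)" by (simp add: image_comp)
  have SM_closed: "closed (S ` ?M)" unfolding SM using S Fr by (rule closed_range_funpow)
  obtain C where C: "C > 0" "\<forall>y\<in>S ` ?M. \<exists>x\<in>?M. S x = y \<and> norm x \<le> C * norm y"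
    using open_mapping_closed_range[OF S.bounded_linear_axioms complex_subspace_imp_subspace[OF M(1)] M(2) SM_closed]
    by blast
  have injM: "x = 0" if x: "x \<in> ?M" "S x = 0" for x
  proof -
    from x(1) obtain y where y: "x = (S ^^ p) y" by auto
    then have "y \<in> null_space (S ^^ Suc p)" using x(2) by (simp add: null_space_def)
    then show ?thesis unfolding p[symmetric] using y by (simp add: null_space_def)
  qed
  have belowM: "norm x \<le> C * norm (S x)" if x: "x \<in> ?M" for x
  proof -
    have "S x \<in> S ` ?M" using x by (rule imageI)
    from bspec[OF C(2) this] obtain x' where x': "x' \<in> ?M" "S x' = S x" "norm x' \<le> C * norm (S x)"
      by blast
    have "S (x - x') = 0" by (simp add: S.diff x'(2))
    with complex_vector.subspace_diff[OF M(1) x x'(1)] have "x - x' = 0" by (rule injM)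
    then show ?thesis using x'(3) by simp
  qed
  have below_shift: "norm x \<le> 2 * C * norm (shift S \<mu> x)"
    if x: "x \<in> ?M" and mu: "cmod \<mu> \<le> 1 / (2 * C)" for x \<mu>
  proof -
    have "norm (S x) \<le> norm (shift S \<mu> x) + cmod \<mu> * norm x"
      using norm_triangle_ineq[of "shift S \<mu> x" "\<mu> *\<^sub>C x"] by (simp add: shift_def norm_scaleC)
    also have "cmod \<mu> * norm x \<le> 1 / (2 * C) * norm x" using mu by (intro mult_right_mono) auto
    finally have "C * norm (S x) \<le> C * (norm (shift S \<mu> x) + 1 / (2 * C) * norm x)"
      using C(1) by (intro mult_left_mono) auto
    also have "\<dots> = C * norm (shift S \<mu> x) + norm x / 2" using C(1) by (simp add: field_simps)
    finally show ?thesis using belowM[OF x] by simp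
  qed
  have surj_shift: "surj (shift S \<mu>)" if mu: "cmod \<mu> \<le> 1 / (2 * C)" "\<mu> \<noteq> 0" for \<mu>
  proof (rule surj)
    let ?R = "shift S \<mu>"
    interpret R: bounded_linear ?R using bounded_clinear_shift[OF S] by (simp add: bounded_clinear_def)
    obtain B where B: "B > 0" "\<And>x. norm (S x) \<le> norm x * B" using S.pos_bounded by blast
    have "\<exists>K\<ge>0. \<forall>x. cmod \<mu> ^ n * norm x \<le> norm ((S ^^ n) x) + K * norm (?R x)" for n
    proof (induction n)
      case 0
      then show ?case by (intro exI[of _ 0]) simp
    next
      case (Suc n)
      then obtain K where K: "K \<ge> 0" "\<And>x. cmod \<mu> ^ n * norm x \<le> norm ((S ^^ n) x) + K * norm (?R x)" by blast
      have "cmod \<mu> ^ Suc n * norm x \<le> norm ((S ^^ Suc n) x) + (K * B + cmod \<mu> ^ n) * norm (?R x)" for x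
      proof -
        have "cmod \<mu> * norm x = norm (S x - ?R x)" by (simp add: shift_def norm_scaleC)
        also have "\<dots> \<le> norm (S x) + norm (?R x)" by (rule norm_triangle_ineq4)
        finally have "cmod \<mu> ^ n * (cmod \<mu> * norm x) \<le> cmod \<mu> ^ n * (norm (S x) + norm (?R x))"
          by (intro mult_left_mono) auto
        also have "cmod \<mu> ^ n * norm (S x) \<le> norm ((S ^^ n) (S x)) + K * norm (?R (S x))" by (rule K(2))
        moreover have "K * norm (?R (S x)) \<le> K * (norm (?R x) * B)"
          using comm[of \<mu> 1 x] B(2)[of "?R x"] K(1) by (intro mult_left_mono) auto
        ultimately show ?thesis by (simp add: algebra_simps funpow_swap1)
      qed
      then show ?case using K(1) B(1) by (intro exI[of _ "K * B + cmod \<mu> ^ n"]) simp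
    qed
    then obtain K where K: "K \<ge> 0" "\<And>x. cmod \<mu> ^ p * norm x \<le> norm ((S ^^ p) x) + K * norm (?R x)" by blast
    have "bounded_linear (S ^^ p)"
      by (induction p) (auto simp: id_def o_def intro: bounded_linear_compose[OF S.bounded_linear_axioms])
    then obtain A where A: "A > 0" "\<And>x. norm ((S ^^ p) x) \<le> norm x * A"
      using bounded_linear.pos_bounded by blast
    define e where "e = cmod \<mu> ^ p / (2 * C * A + K)"
    have "2 * C * A + K > 0" using A(1) C(1) K(1) by (simp add: add_pos_nonneg)
    then have e: "e > 0" using mu(2) by (simp add: e_def)
    have est: "e * norm x \<le> norm (?R x)" for x
    proof -
      have "norm ((S ^^ p) x) \<le> 2 * C * norm (?R ((S ^^ p) x))" using mu(1) by (intro below_shift) auto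
      also have "\<dots> \<le> 2 * C * (norm (?R x) * A)"
        unfolding comm using C(1) A(2) by (intro mult_left_mono) auto
      finally have "cmod \<mu> ^ p * norm x \<le> (2 * C * A + K) * norm (?R x)"
        using K(2)[of x] by (simp add: algebra_simps)
      then show ?thesis using \<open>2 * C * A + K > 0\<close> by (simp add: e_def field_simps)
    qed
    have "complete (range ?R)"
      using e R.bounded_linear_axioms est complete_UNIV by (intro complete_isometric_image[of e]) auto
    moreover have "inj ?R"
    proof (rule linear_injective_0[OF R.linear_axioms, THEN iffD2], intro allI impI)
      fix x assume "?R x = 0"
      then show "x = 0" using est[of x] e by (simp add: mult_le_0_iff)
    qed
    ultimately show "bounded_below ?R" by (simp add: bounded_below_def complete_imp_closed)
  qed
  have "range (S ^^ p) \<subseteq> range (S ^^ Suc p)"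
  proof
    fix y assume "y \<in> range (S ^^ p)"
    then obtain w where w: "y = (S ^^ p) w" by auto
    define \<mu> where "\<mu> n = complex_of_real (1 / (2 * C) * inverse (real (Suc n)))" for n
    have mu: "cmod (\<mu> n) = 1 / (2 * C) * inverse (real (Suc n))" "\<mu> n \<noteq> 0" for n
      using C(1) by (auto simp: \<mu>_def norm_mult norm_divide norm_inverse simp del: of_nat_Suc)
    have mu_le: "cmod (\<mu> n) \<le> 1 / (2 * C)" for n
      unfolding mu(1) using C(1) by (intro mult_left_le) (auto simp: inverse_le_1_iff)
    have "\<forall>n. \<exists>x. x \<in> ?M \<and> shift S (\<mu> n) x = y"
    proof
      fix n
      obtain u where "w = shift S (\<mu> n) u" using surj_shift[OF mu_le mu(2)] by (metis surjD)
      then have "shift S (\<mu> n) ((S ^^ p) u) = y" by (simp add: comm w)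
      then show "\<exists>x. x \<in> ?M \<and> shift S (\<mu> n) x = y" by blast
    qed
    then obtain x where x: "\<And>n. x n \<in> ?M" "\<And>n. shift S (\<mu> n) (x n) = y" by (auto simp only: choice_iff)
    have "(\<lambda>n. S (x n) - y) \<longlonglongrightarrow> 0"
    proof (rule Lim_null_comparison)
      have "norm (S (x n) - y) \<le> norm y * inverse (real (Suc n))" for n
      proof -
        have "S (x n) - y = \<mu> n *\<^sub>C x n" using x(2)[of n] by (simp add: shift_def algebra_simps)
        then have "norm (S (x n) - y) = cmod (\<mu> n) * norm (x n)" by (simp add: norm_scaleC)
        also have "\<dots> \<le> cmod (\<mu> n) * (2 * C * norm y)"
          using below_shift[OF x(1) mu_le, of n n] x(2)[of n] by (intro mult_left_mono) auto
        also have "\<dots> = norm y * inverse (real (Suc n))" unfolding mu(1) using C(1) by simp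
        finally show ?thesis .
      qed
      then show "\<forall>\<^sub>F n in sequentially. norm (S (x n) - y) \<le> norm y * inverse (real (Suc n))" by simp
      show "(\<lambda>n. norm y * inverse (real (Suc n))) \<longlonglongrightarrow> 0"
        using tendsto_mult_left[OF LIMSEQ_inverse_real_of_nat, of "norm y"] by simp
    qed
    then have "(\<lambda>n. S (x n)) \<longlonglongrightarrow> y" by (rule LIM_zero_cancel)
    moreover have "S (x n) \<in> S ` ?M" for n using x(1) by blast
    ultimately have "y \<in> S ` ?M" by (rule closed_sequentially[OF SM_closed, rotated])
    then show "y \<in> range (S ^^ Suc p)" unfolding SM .
  qed
  with range_funpow_Suc_subset[of p S] have "range (S ^^ p) = range (S ^^ Suc p)" by (rule subset_antisym[rotated])
  then show ?thesis using descent_finite_iff[of S] by (simp only:) (rule exI)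
qed

section \<open>Descent and the single-valued extension property of the adjoint\<close>

text \<open>
  A nonconstant \<open>\<phi>\<close> would have a zero of some finite order \<open>n\<close> at \<open>\<xi>\<close>; dividing the assumption for \<open>n + 1\<close> by
  \<open>(w - \<xi>)\<^sup>n\<close> would make its nonvanishing cofactor vanish at \<open>\<xi>\<close>.
\<close>

lemma holomorphic_eq_0_if_flat:
  assumes hol: "\<phi> holomorphic_on ball \<xi> r"
    and flat: "\<And>k. \<exists>\<psi>. \<psi> holomorphic_on ball \<xi> r \<and> (\<forall>w\<in>ball \<xi> r - {\<xi>}. \<phi> w = (w - \<xi>) ^ k * \<psi> w)"
    and w: "w \<in> ball \<xi> r"
  shows "\<phi> w = 0"
proof -
  have r: "r > 0" using w by (metis ball_eq_empty empty_iff not_le)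
  have lim0: "h \<xi> = 0" if h: "h holomorphic_on ball \<xi> s" and psi: "\<psi> holomorphic_on ball \<xi> r"
    and s: "0 < s" "s \<le> r" and eq: "\<And>w. w \<in> ball \<xi> s - {\<xi>} \<Longrightarrow> h w = (w - \<xi>) * \<psi> w" for h \<psi> s
  proof (rule tendsto_unique[OF trivial_limit_at])
    show "(h \<longlongrightarrow> h \<xi>) (at \<xi>)"
      using h s(1) by (metis centre_in_ball continuous_on_interior continuous_within holomorphic_on_imp_continuous_on interior_ball)
    have "(\<psi> \<longlongrightarrow> \<psi> \<xi>) (at \<xi>)"
      using psi r by (metis centre_in_ball continuous_on_interior continuous_within holomorphic_on_imp_continuous_on interior_ball)
    then have "((\<lambda>w. (w - \<xi>) * \<psi> w) \<longlongrightarrow> (\<xi> - \<xi>) * \<psi> \<xi>) (at \<xi>)"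
      by (intro tendsto_intros)
    moreover have "\<forall>\<^sub>F w in at \<xi>. (w - \<xi>) * \<psi> w = h w"
      using eventually_at_ball'[OF s(1), of \<xi> UNIV] by eventually_elim (use eq in auto)
    ultimately show "(h \<longlongrightarrow> 0) (at \<xi>)"
      using tendsto_cong by fastforce
  qed
  have z: "\<phi> \<xi> = 0"
  proof -
    obtain \<psi> where "\<psi> holomorphic_on ball \<xi> r" "\<forall>w\<in>ball \<xi> r - {\<xi>}. \<phi> w = (w - \<xi>) ^ 1 * \<psi> w"
      using flat by blast
    then show ?thesis using lim0[OF hol, of \<psi>] r by simp
  qed
  have "\<phi> constant_on ball \<xi> r"
  proof (rule ccontr)
    assume nonconst: "\<not> \<phi> constant_on ball \<xi> r"
    have "\<xi> \<in> ball \<xi> r" using r by simp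
    then obtain g s n where g: "0 < n" "0 < s" "ball \<xi> s \<subseteq> ball \<xi> r" "g holomorphic_on ball \<xi> s"
      "\<And>w. w \<in> ball \<xi> s \<Longrightarrow> \<phi> w = (w - \<xi>) ^ n * g w" "\<And>w. w \<in> ball \<xi> s \<Longrightarrow> g w \<noteq> 0"
      using holomorphic_factor_zero_nonconstant[OF hol open_ball connected_ball _ z nonconst] by metis
    obtain \<psi> where psi: "\<psi> holomorphic_on ball \<xi> r"
      "\<forall>w\<in>ball \<xi> r - {\<xi>}. \<phi> w = (w - \<xi>) ^ Suc n * \<psi> w"
      using flat by blast
    have "g w = (w - \<xi>) * \<psi> w" if "w \<in> ball \<xi> s - {\<xi>}" for w
    proof -
      have "(w - \<xi>) ^ n * g w = (w - \<xi>) ^ n * ((w - \<xi>) * \<psi> w)"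
        using g(3) g(5)[of w] psi(2) that by (auto simp: mult_ac)
      then show ?thesis using that by simp
    qed
    moreover have "s \<le> r" using g(2,3) by (simp add: ball_subset_ball_iff)
    ultimately have "g \<xi> = 0" using lim0[OF g(4) psi(1) g(2)] by blast
    then show False using g(2,6) by simp
  qed
  then show ?thesis using z w r by (metis centre_in_ball constant_on_def)
qed

lemma cdual_apply_zero_left [simp]: "cdual_apply 0 x = 0"
  by transfer simp

lemma cdual_apply_add_right: "cdual_apply g (x + y) = cdual_apply g x + cdual_apply g y"
  using bounded_linear_cdual_apply by (rule linear_add[OF bounded_linear.linear])

lemma cdual_apply_diff_right: "cdual_apply g (x - y) = cdual_apply g x - cdual_apply g y"
  using bounded_linear_cdual_apply by (rule linear_diff[OF bounded_linear.linear])

lemma cdual_apply_zero_right [simp]: "cdual_apply g 0 = 0"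
  using cdual_apply_diff_right[of g 0 0] by simp

lemma norm_cdual_apply_le: "cmod (cdual_apply g x) \<le> norm g * norm x"
  unfolding norm_cdual_eq_onorm by (rule onorm[OF bounded_linear_cdual_apply])

lemma bounded_linear_eval_cdual: "bounded_linear (\<lambda>g. cdual_apply g x)"
  by (rule bounded_linear_intro[where K = "norm x"])
    (simp_all add: scaleR_scaleC scaleR_conv_of_real norm_cdual_apply_le)

text \<open>
  The duality between \<open>T' - zI\<close> and \<open>T - \<mu>I\<close>: an element of the kernel of \<open>T' - zI\<close> acts on the range of
  \<open>T - \<mu>I\<close> as multiplication by \<open>z - \<mu>\<close>.
\<close>

lemma cdual_apply_shift_adjoint:
  assumes "bounded_clinear T"
  shows "cdual_apply (shift (cadjoint T) z g) x = cdual_apply g (shift T \<mu> x) - (z - \<mu>) * cdual_apply g x"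
  unfolding shift_def linear_diff[OF bounded_linear.linear[OF bounded_linear_eval_cdual]]
  by (simp add: cdual_apply_adjoint[OF assms] cdual_apply_diff_right algebra_simps)

lemma holomorphic_cdual_apply:
  assumes "vector_holomorphic_on f D"
  shows "(\<lambda>z. cdual_apply (f z) x) holomorphic_on D"
proof (rule holomorphic_onI)
  fix z assume "z \<in> D"
  then obtain d where "(f has_derivative (\<lambda>h. h *\<^sub>C d)) (at z)"
    using assms by (auto simp: vector_holomorphic_on_def)
  from bounded_linear.has_derivative[OF bounded_linear_eval_cdual[of x] this]
  have "((\<lambda>z. cdual_apply (f z) x) has_field_derivative cdual_apply d x) (at z)"
    by (rule has_derivative_imp_has_field_derivative) simp
  then show "(\<lambda>z. cdual_apply (f z) x) field_differentiable (at z within D)"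
    using field_differentiable_at_within field_differentiable_def by blast
qed

lemma vector_holomorphic_on_subset:
  "vector_holomorphic_on f D \<Longrightarrow> D' \<subseteq> D \<Longrightarrow> vector_holomorphic_on f D'"
  by (auto simp: vector_holomorphic_on_def)

text \<open>
  Evaluated at \<open>S\<^sup>k y\<close>, where \<open>S = T - \<mu>I\<close>, a section of the kernels of \<open>T' - zI\<close> is divisible by
  \<open>(z - \<mu>)\<^sup>k\<close>; evaluated on \<open>N(S\<^sup>q)\<close> it vanishes. Finite descent makes every \<open>x\<close> a sum of two such elements
  for every \<open>k\<close>, so the section is flat at \<open>\<mu>\<close>.
\<close>

lemma adjoint_kernel_section_eq_0:
  fixes T :: "'a::complex_banach \<Rightarrow> 'a"
  assumes T: "bounded_clinear T" and desc: "descent (shift T \<mu>) < \<infinity>"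
    and f: "vector_holomorphic_on f (ball \<mu> r)"
    and ker: "\<And>z. z \<in> ball \<mu> r \<Longrightarrow> shift (cadjoint T) z (f z) = 0"
    and w: "w \<in> ball \<mu> r"
  shows "f w = 0"
proof (rule cdual_eqI)
  fix x
  define S where "S = shift T \<mu>"
  have S: "clinear S" unfolding S_def by (intro bounded_clinear_imp_clinear bounded_clinear_shift T)
  let ?\<phi> = "\<lambda>u z. cdual_apply (f z) u"
  have phiS: "?\<phi> (S u) z = (z - \<mu>) * ?\<phi> u z" if "z \<in> ball \<mu> r" for u z
    using ker[OF that] cdual_apply_shift_adjoint[OF T, of z "f z" u \<mu>] by (simp add: S_def)
  have phiS_pow: "?\<phi> ((S ^^ k) u) z = (z - \<mu>) ^ k * ?\<phi> u z" if "z \<in> ball \<mu> r" for u z k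
    using phiS[OF that] by (induction k) auto
  obtain q where q: "range (S ^^ q) = range (S ^^ Suc q)"
    using desc unfolding S_def descent_finite_iff by blast
  have "?\<phi> x w = 0"
  proof (rule holomorphic_eq_0_if_flat[OF holomorphic_cdual_apply[OF f] _ w])
    fix k
    obtain y u where yu: "x = (S ^^ k) y + u" "u \<in> null_space (S ^^ q)"
      using range_funpow_stable_decomposition[OF S q] by blast
    have "?\<phi> x z = (z - \<mu>) ^ k * ?\<phi> y z" if z: "z \<in> ball \<mu> r - {\<mu>}" for z
    proof -
      have "(z - \<mu>) ^ q * ?\<phi> u z = cdual_apply (f z) 0"
        using phiS_pow[of z q u] z yu(2) by (simp add: null_space_def)
      then have "?\<phi> u z = 0" using z by simp
      moreover have "?\<phi> x z = ?\<phi> ((S ^^ k) y) z + ?\<phi> u z"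
        unfolding yu(1) by (rule cdual_apply_add_right)
      ultimately show ?thesis using phiS_pow[of z k y] z by simp
    qed
    then show "\<exists>\<psi>. \<psi> holomorphic_on ball \<mu> r \<and> (\<forall>z\<in>ball \<mu> r - {\<mu>}. ?\<phi> x z = (z - \<mu>) ^ k * \<psi> z)"
      using holomorphic_cdual_apply[OF f] by blast
  qed
  then show "cdual_apply (f w) x = cdual_apply 0 x" by simp
qed

lemma adjoint_SVEP_outside_interior_desc_spectrum:
  fixes T :: "'a::complex_banach \<Rightarrow> 'a"
  assumes T: "bounded_clinear T" and notin: "\<nu> \<notin> interior (desc_spectrum T)"
  shows "SVEP_at (cadjoint T) \<nu>"
  unfolding SVEP_at_def
proof (intro allI impI ballI, elim conjE)
  fix r f w
  assume r: "0 < r" and w: "w \<in> ball \<nu> r" and f: "vector_holomorphic_on f (ball \<nu> r)"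
    and ker: "\<forall>z\<in>ball \<nu> r. shift (cadjoint T) z (f z) = 0"
  have "\<not> ball \<nu> r \<subseteq> desc_spectrum T" using notin r mem_interior by blast
  then obtain \<mu> where mu: "\<mu> \<in> ball \<nu> r" "\<not> descent (shift T \<mu>) = \<infinity>"
    unfolding desc_spectrum_def by blast
  then have desc: "descent (shift T \<mu>) < \<infinity>" by simp
  obtain s where s: "s > 0" "ball \<mu> s \<subseteq> ball \<nu> r"
    using mu(1) openE[OF open_ball] by blast
  have zero: "f z = 0" if "z \<in> ball \<mu> s" for z
  proof (rule adjoint_kernel_section_eq_0[OF T desc vector_holomorphic_on_subset[OF f s(2)] _ that])
    show "shift (cadjoint T) y (f y) = 0" if "y \<in> ball \<mu> s" for y
      using ker s(2) that by blast
  qed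
  show "f w = 0"
  proof (rule cdual_eqI)
    fix x
    have "cdual_apply (f w) x = 0"
    proof (rule analytic_continuation[OF holomorphic_cdual_apply[OF f] open_ball connected_ball s(2) mu(1) _ _ w])
      show "\<mu> islimpt ball \<mu> s" using s(1) by (intro interior_limit_point) simp
    qed (simp add: zero)
    then show "cdual_apply (f w) x = cdual_apply 0 x" by simp
  qed
qed

text \<open>
  The radius \<open>1 / (4 C)\<close> leaves enough room for the crude bound \<open>k < 2\<^sup>k\<close> on the factor \<open>k\<close> of the derived series,
  which then converges uniformly by comparison with a geometric series of ratio \<open>1/2\<close>.
\<close>

lemma vector_power_series_holomorphic:
  fixes a :: "nat \<Rightarrow> 'a::complex_banach"
  assumes C: "C > 0" and a: "\<And>k. norm (a k) \<le> C ^ k"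
  obtains f where "vector_holomorphic_on f (ball \<xi> (1 / (4 * C)))"
    "\<And>z. z \<in> ball \<xi> (1 / (4 * C)) \<Longrightarrow> (\<lambda>k. (z - \<xi>) ^ k *\<^sub>C a k) sums f z"
proof -
  let ?B = "ball \<xi> (1 / (4 * C))"
  define D where "D k z = (of_nat k * (z - \<xi>) ^ (k - 1)) *\<^sub>C a k" for k z
  have bl: "bounded_linear (\<lambda>h. h *\<^sub>C b)" for b :: 'a
    by (rule bounded_linear_intro[where K = "norm b"])
      (simp_all add: scaleC_add_left norm_scaleC scaleR_conv_of_real scaleR_scaleC scaleC_scaleC)
  have zC: "cmod (z - \<xi>) * C \<le> 1 / 4" if "z \<in> ?B" for z
    using that C by (simp add: dist_norm norm_minus_commute field_simps)
  have D_le: "norm (D k z) \<le> 4 * C * (1 / 2) ^ k" if z: "z \<in> ?B" for k z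
  proof (cases k)
    case 0
    then show ?thesis using C by (simp add: D_def)
  next
    case (Suc m)
    have "norm (D k z) = real k * cmod (z - \<xi>) ^ m * norm (a k)"
      by (simp add: D_def Suc norm_scaleC norm_mult norm_power del: of_nat_Suc)
    also have "\<dots> \<le> real k * cmod (z - \<xi>) ^ m * C ^ k"
      using a by (intro mult_left_mono) auto
    also have "\<dots> = C * real k * (cmod (z - \<xi>) * C) ^ m" by (simp add: Suc power_mult_distrib)
    also have "\<dots> \<le> C * real k * (1 / 4) ^ m"
      using zC[OF z] C by (intro mult_left_mono power_mono) auto
    also have "\<dots> \<le> C * 2 ^ k * (1 / 4) ^ m"
      using C of_nat_less_two_power[of k, where 'a = real]
      by (intro mult_right_mono mult_left_mono) auto
    also have "\<dots> = 4 * C * (1 / 2) ^ k"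
      by (simp add: Suc power_divide field_simps flip: power_mult_distrib)
    finally show ?thesis .
  qed
  have "summable (\<lambda>k. 4 * C * (1 / 2 :: real) ^ k)" by (intro summable_mult summable_geometric) simp
  then have unif: "uniform_limit ?B (\<lambda>n z. \<Sum>k<n. D k z) (\<lambda>z. \<Sum>k. D k z) sequentially"
    using D_le by (intro Weierstrass_m_test) auto
  have "\<exists>f. \<forall>z\<in>?B. (\<lambda>k. (z - \<xi>) ^ k *\<^sub>C a k) sums f z \<and>
      (f has_derivative (\<lambda>h. h *\<^sub>C (\<Sum>k. D k z))) (at z within ?B)"
  proof (rule has_derivative_series)
    show "convex ?B" by simp
    show "((\<lambda>z. (z - \<xi>) ^ n *\<^sub>C a n) has_derivative (\<lambda>h. h *\<^sub>C D n z)) (at z within ?B)" for n z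
    proof -
      have "((\<lambda>z. (z - \<xi>) ^ n) has_derivative (\<lambda>h. h * (of_nat n * (z - \<xi>) ^ (n - 1)))) (at z within ?B)"
        by (auto intro!: derivative_eq_intros)
      from bounded_linear.has_derivative[OF bl this]
      show ?thesis by (simp add: D_def scaleC_scaleC)
    qed
    fix e :: real assume "e > 0"
    with unif have "\<forall>\<^sub>F n in sequentially. \<forall>z\<in>?B. dist (\<Sum>k<n. D k z) (\<Sum>k. D k z) < e"
      by (rule uniform_limitD)
    then show "\<forall>\<^sub>F n in sequentially. \<forall>z\<in>?B. \<forall>h.
        norm ((\<Sum>i<n. h *\<^sub>C D i z) - h *\<^sub>C (\<Sum>k. D k z)) \<le> e * norm h"
    proof eventually_elim
      case (elim n)
      show ?case
      proof (intro ballI allI)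
        fix z h assume "z \<in> ?B"
        have "norm ((\<Sum>i<n. h *\<^sub>C D i z) - h *\<^sub>C (\<Sum>k. D k z)) = cmod h * norm ((\<Sum>i<n. D i z) - (\<Sum>k. D k z))"
          by (simp add: norm_scaleC flip: complex_vector.scale_sum_right complex_vector.scale_right_diff_distrib)
        also have "\<dots> \<le> cmod h * e"
          using elim \<open>z \<in> ?B\<close> by (intro mult_left_mono) (auto simp: dist_norm less_imp_le)
        finally show "norm ((\<Sum>i<n. h *\<^sub>C D i z) - h *\<^sub>C (\<Sum>k. D k z)) \<le> e * norm h"
          by (simp add: mult.commute)
      qed
    qed
  next
    show "\<xi> \<in> ?B" using C by simp
    show "(\<lambda>k. (\<xi> - \<xi>) ^ k *\<^sub>C a k) sums a 0"
      using sums_single[of 0 a] by (rule back_subst[of "\<lambda>g. g sums a 0"]) (auto simp: fun_eq_iff)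
  qed
  then obtain f where f: "\<And>z. z \<in> ?B \<Longrightarrow> (\<lambda>k. (z - \<xi>) ^ k *\<^sub>C a k) sums f z"
    "\<And>z. z \<in> ?B \<Longrightarrow> (f has_derivative (\<lambda>h. h *\<^sub>C (\<Sum>k. D k z))) (at z within ?B)"
    by blast
  have "vector_holomorphic_on f ?B"
    unfolding vector_holomorphic_on_def using f(2) at_within_open[OF _ open_ball] by fastforce
  with f(1) show thesis using that by blast
qed

text \<open>
  The point is to lift functionals: if \<open>a\<close> vanishes on all \<open>N(S\<^sup>m)\<close>, there is \<open>b\<close> with the same property,
  \<open>b \<circ> S = a\<close> and \<open>\<parallel>b\<parallel> \<le> C \<parallel>a\<parallel>\<close> with \<open>C\<close> independent of \<open>a\<close>. On \<open>R(S) + N(S\<^sup>q)\<close> the value of \<open>b\<close> at \<open>S x + w\<close> has to be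
  \<open>a x\<close>; the open mapping theorem bounds it and the Hahn-Banach theorem extends it to \<open>X\<close>. Because all
  \<open>N(S\<^sup>m)\<close> lie in this subspace, \<open>b\<close> again vanishes on them, and the lifting can be iterated.
\<close>

lemma descent_finite_if_adjoint_SVEP:
  fixes T :: "'a::complex_banach \<Rightarrow> 'a"
  assumes T: "bounded_clinear T" and Fr: "upper_semi_Fredholm (shift T \<mu>)"
    and svep: "SVEP_at (cadjoint T) \<mu>"
  shows "descent (shift T \<mu>) < \<infinity>"
proof (rule ccontr)
  assume desc: "\<not> descent (shift T \<mu>) < \<infinity>"
  define S where "S = shift T \<mu>"
  have bS: "bounded_clinear S" unfolding S_def by (intro bounded_clinear_shift T)
  then have S: "clinear S" by (rule bounded_clinear_imp_clinear)
  have clR: "closed (range S)" and fin: "nullity S < \<infinity>"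
    using Fr by (simp_all add: S_def upper_semi_Fredholm_def)
  interpret S: bounded_linear S using bS by (simp add: bounded_clinear_def)
  have SC: "S (c *\<^sub>C x) = c *\<^sub>C S x" for c x using bS by (simp add: bounded_clinear_def)
  obtain q where q: "\<And>m u. u \<in> null_space (S ^^ m) \<Longrightarrow> \<exists>x w. u = S x + w \<and> w \<in> null_space (S ^^ q)"
    using null_space_funpow_absorbed[OF S fin] by metis
  let ?F = "null_space (S ^^ q)"
  let ?V = "{v + w | v w. v \<in> range S \<and> w \<in> ?F}"
  have F: "complex_vector.subspace ?F" "cdim ?F < \<infinity>"
    using subspace_null_space[OF clinear_funpow[OF S]] cdim_null_space_funpow_finite[OF S fin] by blast+
  have V: "complex_vector.subspace ?V" "closed ?V"
    using complex_vector.subspace_sums[OF subspace_range[OF S] F(1)]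
      closed_subspace_plus_finite_dim[OF subspace_range[OF S] clR F] by blast+
  obtain x0 where x0: "x0 \<notin> ?V"
  proof (rule ccontr)
    assume "\<not> thesis"
    then have all: "\<And>x. x \<in> ?V" using that by blast
    have "\<exists>y z. x = S y + z \<and> z \<in> ?F" for x using all[of x] by blast
    then have "range (S ^^ q) = range (S ^^ Suc q)" by (rule range_funpow_stable_if_decomposition[OF S])
    then show False using desc descent_finite_iff unfolding S_def by blast
  qed
  obtain C where C: "C > 0" "\<And>v. v \<in> ?V \<Longrightarrow> \<exists>x w. v = S x + w \<and> w \<in> ?F \<and> norm x \<le> C * norm v"
  proof -
    let ?g = "\<lambda>(x, w). S x + w"
    have g: "bounded_linear ?g"
      unfolding case_prod_beta
      by (intro bounded_linear_add bounded_linear_compose[OF S.bounded_linear_axioms] bounded_linear_fst bounded_linear_snd)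
    have img: "?g ` (UNIV \<times> ?F) = ?V" by auto
    have "subspace (UNIV \<times> ?F)"
      using complex_subspace_imp_subspace[OF F(1)] by (simp add: subspace_Times)
    moreover have "closed (UNIV \<times> ?F)"
      using closed_finite_dim[OF F] by (simp add: closed_Times)
    moreover have "closed (?g ` (UNIV \<times> ?F))" unfolding img by (rule V(2))
    ultimately obtain C where C: "C > 0"
      "\<forall>v\<in>?g ` (UNIV \<times> ?F). \<exists>p\<in>UNIV \<times> ?F. ?g p = v \<and> norm p \<le> C * norm v"
      using open_mapping_closed_range[OF g] by blast
    have "\<exists>x w. v = S x + w \<and> w \<in> ?F \<and> norm x \<le> C * norm v" if v: "v \<in> ?V" for v
    proof -
      obtain x w where "w \<in> ?F" "S x + w = v" "norm (x, w) \<le> C * norm v"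
        using bspec[OF C(2)[unfolded img] v] by auto
      moreover have "norm x \<le> norm (x, w)" by (rule norm_fst_le)
      ultimately show ?thesis by force
    qed
    with C(1) show thesis by (rule that)
  qed
  define good where "good g \<longleftrightarrow> (\<forall>m. \<forall>u\<in>null_space (S ^^ m). cdual_apply g u = 0)" for g :: "'a cdual"
  \<comment> \<open>One step of the backward orbit of the adjoint of \<open>S\<close>.\<close>
  have lift: "\<exists>b. good b \<and> (\<forall>x. cdual_apply b (S x) = cdual_apply a x) \<and> norm b \<le> C * norm a"
    if a: "good a" for a
  proof -
    let ?G = "{(S x + w, cdual_apply a x) | x w. w \<in> ?F}"
    have kill: "cdual_apply a x = 0" if x: "S x \<in> null_space (S ^^ m)" for x m
    proof -
      have "x \<in> null_space (S ^^ Suc m)" using x by (simp add: null_space_def funpow_swap1)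
      then show ?thesis using a unfolding good_def by blast
    qed
    obtain b where b: "\<And>v c. (v, c) \<in> ?G \<Longrightarrow> cdual_apply b v = c" "norm b \<le> C * norm a"
    proof (rule hahn_banach_complex[of ?G "C * norm a"])
      have "(S 0 + 0, cdual_apply a 0) \<in> ?G" using complex_vector.subspace_0[OF F(1)] by blast
      then show "(0, 0) \<in> ?G" by (simp add: S.zero)
      show "(u + v, c + d) \<in> ?G" if uv: "(u, c) \<in> ?G" "(v, d) \<in> ?G" for u c v d
      proof -
        obtain x w where 1: "w \<in> ?F" "u = S x + w" "c = cdual_apply a x" using uv(1) by blast
        obtain y z where 2: "z \<in> ?F" "v = S y + z" "d = cdual_apply a y" using uv(2) by blast
        have "u + v = S (x + y) + (w + z)" "c + d = cdual_apply a (x + y)"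
          using 1 2 by (simp_all add: S.add cdual_apply_add_right)
        moreover have "w + z \<in> ?F" using F(1) 1(1) 2(1) by (rule complex_vector.subspace_add)
        ultimately show ?thesis by blast
      qed
      show "(k *\<^sub>C u, k * c) \<in> ?G" if u: "(u, c) \<in> ?G" for k u c
      proof -
        obtain x w where 1: "w \<in> ?F" "u = S x + w" "c = cdual_apply a x" using u by blast
        have "k *\<^sub>C u = S (k *\<^sub>C x) + k *\<^sub>C w" "k * c = cdual_apply a (k *\<^sub>C x)"
          using 1 by (simp_all add: SC scaleC_add_right)
        moreover have "k *\<^sub>C w \<in> ?F" using F(1) 1(1) by (rule complex_vector.subspace_scale)
        ultimately show ?thesis by blast
      qed
      \<comment> \<open>Replacing the preimage by a small one does not change the value, since \<open>a\<close> kills the ambiguity.\<close>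
      show "cmod c \<le> C * norm a * norm v" if v: "(v, c) \<in> ?G" for v c
      proof -
        obtain x w where 1: "w \<in> ?F" "v = S x + w" "c = cdual_apply a x" using v by blast
        then have "v \<in> ?V" by blast
        then obtain x' w' where 2: "v = S x' + w'" "w' \<in> ?F" "norm x' \<le> C * norm v" using C(2) by blast
        have "S (x - x') = w' - w" using 1(2) 2(1) by (simp add: S.diff algebra_simps)
        moreover have "w' - w \<in> ?F" using F(1) 2(2) 1(1) by (rule complex_vector.subspace_diff)
        ultimately have "cdual_apply a (x - x') = 0" using kill by simp
        then have "c = cdual_apply a x'" using 1(3) by (simp add: cdual_apply_diff_right)
        also have "cmod \<dots> \<le> norm a * norm x'"
          by (rule norm_cdual_apply_le)
        also have "\<dots> \<le> norm a * (C * norm v)" using 2(3) by (intro mult_left_mono) auto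
        finally show ?thesis by (simp add: mult_ac)
      qed
      show "0 \<le> C * norm a" using C(1) by simp
    qed (rule that)
    have "cdual_apply b (S x) = cdual_apply a x" for x
    proof (rule b(1))
      have "(S x + 0, cdual_apply a x) \<in> ?G" using complex_vector.subspace_0[OF F(1)] by blast
      then show "(S x, cdual_apply a x) \<in> ?G" by simp
    qed
    moreover have "good b"
      unfolding good_def
    proof (intro allI ballI)
      fix m u assume u: "u \<in> null_space (S ^^ m)"
      then obtain x w where xw: "u = S x + w" "w \<in> ?F" using q by blast
      then have "cdual_apply b u = cdual_apply a x" by (intro b(1)) blast
      moreover have "S x \<in> null_space (S ^^ max m q)"
      proof -
        have "u \<in> null_space (S ^^ max m q)" "w \<in> null_space (S ^^ max m q)"
          using u xw(2) null_space_funpow_mono[OF S, of m "max m q"]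
            null_space_funpow_mono[OF S, of q "max m q"] by auto
        then have "u - w \<in> null_space (S ^^ max m q)"
          by (rule complex_vector.subspace_diff[OF subspace_null_space[OF clinear_funpow[OF S]]])
        then show ?thesis using xw(1) by simp
      qed
      ultimately show "cdual_apply b u = 0" using kill by simp
    qed
    ultimately show ?thesis using b(2) by blast
  qed
  obtain g where g: "cdual_apply g x0 = 1" "\<forall>v\<in>?V. cdual_apply g v = 0"
    using ex_cdual_annihilating[OF V x0] by blast
  have "g \<noteq> 0" using g(1) by auto
  define a0 where "a0 = (1 / norm g) *\<^sub>R g"
  have a0: "norm a0 = 1" using \<open>g \<noteq> 0\<close> by (simp add: a0_def)
  have a0V: "cdual_apply a0 v = 0" if "v \<in> ?V" for v
    using bspec[OF g(2) that] by (simp add: a0_def scaleR_scaleC)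
  have "good a0"
    unfolding good_def
  proof (intro allI ballI)
    fix m u assume "u \<in> null_space (S ^^ m)"
    then have "u \<in> ?V" using q by blast
    then show "cdual_apply a0 u = 0" by (rule a0V)
  qed
  have "\<forall>a. \<exists>b. good a \<longrightarrow> good b \<and> (\<forall>x. cdual_apply b (S x) = cdual_apply a x) \<and> norm b \<le> C * norm a"
    using lift by blast
  from choice[OF this] obtain L where "\<forall>a. good a \<longrightarrow> good (L a) \<and>
      (\<forall>x. cdual_apply (L a) (S x) = cdual_apply a x) \<and> norm (L a) \<le> C * norm a" ..
  then have L: "\<And>a. good a \<Longrightarrow> good (L a)"
    "\<And>a x. good a \<Longrightarrow> cdual_apply (L a) (S x) = cdual_apply a x"
    "\<And>a. good a \<Longrightarrow> norm (L a) \<le> C * norm a"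
    by blast+
  define a where "a k = (L ^^ k) a0" for k
  have good_a: "good (a k)" for k
    by (induction k) (use \<open>good a0\<close> L(1) in \<open>auto simp: a_def\<close>)
  have a_S0: "cdual_apply (a 0) (S x) = 0" for x
  proof -
    have "S x + 0 \<in> ?V" using complex_vector.subspace_0[OF F(1)] by blast
    then show ?thesis using a0V by (simp add: a_def)
  qed
  have a_S: "cdual_apply (a (Suc k)) (S x) = cdual_apply (a k) x" for k x
    using L(2)[OF good_a[of k]] by (simp add: a_def)
  have a_norm: "norm (a k) \<le> C ^ k" for k
  proof (induction k)
    case 0
    then show ?case using a0 by (simp add: a_def)
  next
    case (Suc k)
    have "norm (a (Suc k)) \<le> C * norm (a k)" using L(3)[OF good_a[of k]] by (simp add: a_def)
    also have "\<dots> \<le> C * C ^ k" using Suc C(1) by (intro mult_left_mono) auto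
    finally show ?case by simp
  qed
  obtain f where f: "vector_holomorphic_on f (ball \<mu> (1 / (4 * C)))"
    "\<And>z. z \<in> ball \<mu> (1 / (4 * C)) \<Longrightarrow> (\<lambda>k. (z - \<mu>) ^ k *\<^sub>C a k) sums f z"
    using vector_power_series_holomorphic[OF C(1) a_norm] by metis
  have "shift (cadjoint T) z (f z) = 0" if z: "z \<in> ball \<mu> (1 / (4 * C))" for z
  proof (rule cdual_eqI)
    fix x
    have sums: "(\<lambda>k. (z - \<mu>) ^ k * cdual_apply (a k) y) sums cdual_apply (f z) y" for y
      using bounded_linear.sums[OF bounded_linear_eval_cdual f(2)[OF z], of y] by simp
    have "(\<lambda>k. (z - \<mu>) * ((z - \<mu>) ^ k * cdual_apply (a k) x)) sums ((z - \<mu>) * cdual_apply (f z) x)"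
      using sums by (rule sums_mult)
    then have "(\<lambda>k. (z - \<mu>) ^ Suc k * cdual_apply (a (Suc k)) (S x)) sums ((z - \<mu>) * cdual_apply (f z) x)"
      by (simp add: a_S mult_ac)
    \<comment> \<open>The term for \<open>k = 0\<close> vanishes because \<open>a 0\<close> annihilates the range of \<open>S\<close>.\<close>
    then have "(\<lambda>k. (z - \<mu>) ^ k * cdual_apply (a k) (S x)) sums ((z - \<mu>) * cdual_apply (f z) x)"
      by (subst (asm) sums_Suc_iff) (simp add: a_S0)
    then have "cdual_apply (f z) (S x) = (z - \<mu>) * cdual_apply (f z) x"
      using sums sums_unique2 by blast
    then show "cdual_apply (shift (cadjoint T) z (f z)) x = cdual_apply 0 x"
      using cdual_apply_shift_adjoint[OF T, of z "f z" x \<mu>] by (simp add: S_def)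
  qed
  moreover have center: "\<mu> \<in> ball \<mu> (1 / (4 * C))" "1 / (4 * C) > 0" using C(1) by auto
  ultimately have "f \<mu> = 0" using svep f(1) unfolding SVEP_at_def by blast
  moreover have "f \<mu> = a 0"
  proof (rule sums_unique2[OF f(2)[OF center(1)]])
    show "(\<lambda>k. (\<mu> - \<mu>) ^ k *\<^sub>C a k) sums a 0"
      using sums_single[of 0 a] by (rule back_subst[of "\<lambda>g. g sums a 0"]) (auto simp: fun_eq_iff)
  qed
  ultimately show False using a0 by (simp add: a_def)
qed


section \<open>a-Browder's theorem and the descent spectrum\<close>

text \<open>
  If \<open>S\<close> is injective then so is \<open>S\<^sup>q\<close>, and \<open>X = R(S) + N(S\<^sup>q)\<close> becomes \<open>X = R(S)\<close>.
\<close>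

lemma surj_if_injective_descent_finite:
  fixes S :: "'a::complex_normed_vector \<Rightarrow> 'a"
  assumes S: "clinear S" and inj: "null_space S = {0}" and desc: "descent S < \<infinity>"
  shows "surj S"
proof -
  from desc[unfolded descent_finite_iff] obtain q where q: "range (S ^^ q) = range (S ^^ Suc q)" ..
  interpret S: Vector_Spaces.linear scaleC scaleC S by (rule S)
  have "null_space (S ^^ n) = {0}" for n
  proof (induction n)
    case (Suc n)
    show ?case
    proof
      show "null_space (S ^^ Suc n) \<subseteq> {0}"
      proof
        fix x assume "x \<in> null_space (S ^^ Suc n)"
        then have "(S ^^ n) x \<in> null_space S" by (simp add: null_space_def)
        then have "x \<in> null_space (S ^^ n)" unfolding inj by (simp add: null_space_def)
        then show "x \<in> {0}" unfolding Suc .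
      qed
      show "{0} \<subseteq> null_space (S ^^ Suc n)"
        using complex_vector.subspace_0[OF subspace_null_space[OF clinear_funpow[OF S, of "Suc n"]]]
        by (simp del: funpow.simps)
    qed
  qed (simp add: null_space_def)
  then have "\<exists>y. x = S y" for x
    using range_funpow_stable_decomposition[OF S q, of x 1] by simp
  then show ?thesis by (simp add: surj_def)
qed

lemma desc_subset_uw_imp_a_Browder:
  fixes T :: "'a::complex_banach \<Rightarrow> 'a"
  assumes T: "bounded_clinear T" and sub: "desc_spectrum T \<subseteq> uw_spectrum T"
  shows "a_Browder_theorem T" "spectrum T = ap_spectrum T"
proof -
  have lin: "clinear (shift T \<mu>)" for \<mu>
    by (intro bounded_clinear_imp_clinear bounded_clinear_shift T)
  have desc: "descent (shift T \<mu>) < \<infinity>" if "upper_semi_Weyl (shift T \<mu>)" for \<mu>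
    using sub that by (auto simp: desc_spectrum_def uw_spectrum_def subset_iff)
  have "upper_semi_Weyl (shift T \<mu>) \<longleftrightarrow> upper_semi_Browder (shift T \<mu>)" for \<mu>
  proof
    assume W: "upper_semi_Weyl (shift T \<mu>)"
    then have "ascent (shift T \<mu>) < \<infinity>"
      using ascent_finite_if_descent_finite[OF lin _ desc] by (simp add: upper_semi_Weyl_iff)
    with W show "upper_semi_Browder (shift T \<mu>)"
      by (simp add: upper_semi_Browder_def upper_semi_Weyl_def)
  next
    assume "upper_semi_Browder (shift T \<mu>)"
    then show "upper_semi_Weyl (shift T \<mu>)"
      using nullity_le_deficiency_if_ascent_finite[OF lin]
      by (simp add: upper_semi_Browder_def upper_semi_Fredholm_def upper_semi_Weyl_iff)
  qed
  then show "a_Browder_theorem T"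
    by (simp add: a_Browder_theorem_def uw_spectrum_def ub_spectrum_def)
  have "\<mu> \<notin> spectrum T \<longleftrightarrow> \<mu> \<notin> ap_spectrum T" for \<mu>
  proof
    assume "\<mu> \<notin> spectrum T"
    then show "\<mu> \<notin> ap_spectrum T"
      by (simp add: not_in_spectrum_iff[OF T] ap_spectrum_def bounded_below_def)
  next
    assume "\<mu> \<notin> ap_spectrum T"
    then have bb: "bounded_below (shift T \<mu>)" by (simp add: ap_spectrum_def)
    then have N: "closed (range (shift T \<mu>))" "null_space (shift T \<mu>) = {0}"
      by (simp_all add: bounded_below_iff[OF lin])
    then have "upper_semi_Weyl (shift T \<mu>)" by (simp add: upper_semi_Weyl_iff nullity_eq_0)
    then have "surj (shift T \<mu>)"
      using surj_if_injective_descent_finite[OF lin N(2)] desc by blast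
    with bb show "\<mu> \<notin> spectrum T" by (simp add: not_in_spectrum_iff[OF T] bounded_below_def)
  qed
  then show "spectrum T = ap_spectrum T" by blast
qed

lemma a_Browder_imp_desc_subset_uw:
  fixes T :: "'a::complex_banach \<Rightarrow> 'a"
  assumes T: "bounded_clinear T" and Br: "a_Browder_theorem T" and sp: "spectrum T = ap_spectrum T"
  shows "desc_spectrum T \<subseteq> uw_spectrum T"
proof
  fix \<mu> assume mu: "\<mu> \<in> desc_spectrum T"
  show "\<mu> \<in> uw_spectrum T"
  proof (rule ccontr)
    assume "\<mu> \<notin> uw_spectrum T"
    then have "\<mu> \<notin> ub_spectrum T" using Br by (simp add: a_Browder_theorem_def)
    then have B: "upper_semi_Browder (shift T \<mu>)" by (simp add: ub_spectrum_def)
    have "surj (shift (shift T \<mu>) \<nu>)" if "bounded_below (shift (shift T \<mu>) \<nu>)" for \<nu>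
    proof -
      have "\<mu> + \<nu> \<notin> ap_spectrum T" using that by (simp add: shift_shift ap_spectrum_def)
      then show ?thesis using sp not_in_spectrum_iff[OF T, of "\<mu> + \<nu>"] by (simp add: shift_shift)
    qed
    with bounded_clinear_shift[OF T] B have "descent (shift T \<mu>) < \<infinity>"
      by (rule descent_finite_if_nearby_surjective)
    with mu show False by (simp add: desc_spectrum_def)
  qed
qed

theorem theorem3p2:
  fixes T :: "'a::complex_banach \<Rightarrow> 'a"
  assumes "cdim (UNIV :: 'a set) = \<infinity>"
    and "bounded_clinear T"
  shows "(interior (desc_spectrum T) \<subseteq> uw_spectrum T \<longleftrightarrow>
            (\<forall>\<mu>. \<mu> \<notin> uw_spectrum T \<longrightarrow> SVEP_at (cadjoint T) \<mu>))
       \<and> ((\<forall>\<mu>. \<mu> \<notin> uw_spectrum T \<longrightarrow> SVEP_at (cadjoint T) \<mu>) \<longleftrightarrow>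
            desc_spectrum T \<subseteq> uw_spectrum T)
       \<and> (desc_spectrum T \<subseteq> uw_spectrum T \<longleftrightarrow>
            a_Browder_theorem T \<and> spectrum T = ap_spectrum T)"
proof -
  note T = assms(2)
  let ?svep = "\<forall>\<mu>. \<mu> \<notin> uw_spectrum T \<longrightarrow> SVEP_at (cadjoint T) \<mu>"
  have "interior (desc_spectrum T) \<subseteq> uw_spectrum T \<Longrightarrow> ?svep"
    using adjoint_SVEP_outside_interior_desc_spectrum[OF T] by blast
  moreover have "?svep \<Longrightarrow> desc_spectrum T \<subseteq> uw_spectrum T"
  proof
    fix \<mu> assume svep: ?svep and mu: "\<mu> \<in> desc_spectrum T"
    show "\<mu> \<in> uw_spectrum T"
    proof (rule ccontr)
      assume "\<mu> \<notin> uw_spectrum T"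
      with svep have "SVEP_at (cadjoint T) \<mu>" "upper_semi_Fredholm (shift T \<mu>)"
        by (simp_all add: uw_spectrum_def upper_semi_Weyl_def)
      then have "descent (shift T \<mu>) < \<infinity>" by (intro descent_finite_if_adjoint_SVEP[OF T])
      with mu show False by (simp add: desc_spectrum_def)
    qed
  qed
  moreover have "desc_spectrum T \<subseteq> uw_spectrum T \<Longrightarrow> interior (desc_spectrum T) \<subseteq> uw_spectrum T"
    using interior_subset by blast
  ultimately show ?thesis
    using desc_subset_uw_imp_a_Browder[OF T] a_Browder_imp_desc_subset_uw[OF T] by blast
qed

end
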